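(* Let $E$ be a Banach lattice with order continuous norm. The following conditions are equivalent. (i) $E$ is a KB-space. (ii) $\mathrm{L}(E,Y)=\mathrm{L}_{\mathrm{KB}}(E,Y)$ for each Banach space $Y$. (iii) $\mathrm{L}_{\mathrm{qKB}}(E,Y)=\mathrm{L}_{\mathrm{KB}}(E,Y)$ for each Banach space $Y$. (iv) $\mathrm{L}_{\mathrm{qKB}+}(E,F)=\mathrm{L}_{\mathrm{KB}+}(E,F)$ for each Banach lattice $F$. (v) $\mathrm{L}_{\mathrm{qKB}+}(E)=\mathrm{L}_{\mathrm{KB}+}(E)$. (vi) $\mathrm{K}_+(E)\subseteq \mathrm{L}_{\mathrm{KB}}(E)$.
   Context: All vector spaces are real and all operators are linear and bounded. For a Banach lattice $E$, $B_E$ is the closed unit ball, $E_+$ the positive cone, and $(B_E)_+=B_E\cap E_+$. A Banach lattice is a KB-space if every norm bounded increasing sequence (equivalently, net) in $E_+$ is norm convergent. For a Banach lattice $E$ and a Banach space $Y$, $\mathrm{L}(E,Y)$ is the space of all bounded operators from $E$ to $Y$ and $\mathrm{K}(E,Y)$ the space of compact ones. An operator $T\in \mathrm{L}(E,Y)$ is: - KB if for every increasing net $(x_\alpha)$ in $(B_E)_+$ there exists $x\in E$ such that $\|Tx_\alpha-Tx\|\to 0$; the set of all such operators is $\mathrm{L}_{\mathrm{KB}}(E,Y)$; - quasi-KB if $(Tx_\alpha)$ is norm convergent in $Y$ for every increasing net $(x_\alpha)$ in $(B_E)_+$; the set of all such operators is $\mathrm{L}_{\mathrm{qKB}}(E,Y)$.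 When the range is a Banach lattice $F$, a subscript $+$ (as in $\mathrm{L}_{\mathrm{KB}+}(E,F)$, $\mathrm{L}_{\mathrm{qKB}+}(E,F)$, $\mathrm{K}_+(E,F)$) denotes the set of positive operators belonging to the corresponding class. A single argument $(E)$ abbreviates $(E,E)$. *)

theory Defs
  imports
    "HOL-Analysis.Analysis"
    "HOL-Library.Lattice_Algebras"
    "HOL-Algebra.Algebra"
    "HOL-Algebra.Algebraic_Closure_Type"
begin

class banach_lattice = banach + ordered_real_vector + lattice_ab_group_add_abs +
  assumes norm_mono_abs: "\<bar>x\<bar> \<le> \<bar>y\<bar> \<Longrightarrow> norm x \<le> norm y"


text \<open>
  A quantification over all Banach spaces (or all Banach lattices) inside a formula cannot range
  over type class instances. Codomains of operators are therefore structures with an explicit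
  carrier, built on the modules of HOL-Algebra over the ring of reals. The record fields
  \<^const>\<open>mult\<close> and \<^const>\<open>one\<close>, inherited from the module record, play no role.

  For a Banach lattice on a type \<open>'a\<close>, carriers and net index sets are taken as subsets of a
  universe \<open>'a + 'u\<close> with \<open>'u\<close> an arbitrary type. Instantiating \<open>'u\<close> makes the universe contain
  a copy of any given space or index set; the summand \<open>'a\<close> ensures that it is never too small
  for the given lattice itself to occur as a codomain.
\<close>

record 'y normed_structure = "(real, 'y) module" +
  nrm :: "'y \<Rightarrow> real"

record 'y normed_order_structure = "'y normed_structure" +
  leq :: "'y \<Rightarrow> 'y \<Rightarrow> bool"

abbreviation real_ring :: "real ring"
  where "real_ring \<equiv> ring_of_type_algebra"

text \<open>The value 0 off the carrier meets the unrestricted axioms of \<^locale>\<open>Metric_space\<close>.\<close>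

definition ndist :: "('y, 'm) normed_structure_scheme \<Rightarrow> 'y \<Rightarrow> 'y \<Rightarrow> real"
  where "ndist Y x y =
    (if x \<in> carrier Y \<and> y \<in> carrier Y then nrm Y (x \<ominus>\<^bsub>Y\<^esub> y) else 0)"

locale banach_space = module real_ring Y
  for Y :: "('y, 'm) normed_structure_scheme" (structure) +
  assumes nrm_eq_0_iff: "x \<in> carrier Y \<Longrightarrow> nrm Y x = 0 \<longleftrightarrow> x = \<zero>"
    and nrm_triangle: "x \<in> carrier Y \<Longrightarrow> y \<in> carrier Y \<Longrightarrow> nrm Y (x \<oplus> y) \<le> nrm Y x + nrm Y y"
    and nrm_smult: "x \<in> carrier Y \<Longrightarrow> nrm Y (a \<odot>\<^bsub>Y\<^esub> x) = \<bar>a\<bar> * nrm Y x"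
    and complete: "Metric_space.mcomplete (carrier Y) (ndist Y)"

lemma (in banach_space) Metric_space_ndist: "Metric_space (carrier Y) (ndist Y)"
proof -
  have neg: "(\<ominus>\<^bsub>real_ring\<^esub> (1::real)) = -1"
    by (rule R.minus_equality) (auto simp: ring_of_type_algebra_def)
  have carr: "a \<in> carrier real_ring" for a :: real
    by (simp add: ring_of_type_algebra_def)
  have "\<one>\<^bsub>real_ring\<^esub> = (1::real)"
    by (simp add: ring_of_type_algebra_def)
  then have neg_smult: "\<ominus> x = (-1) \<odot>\<^bsub>Y\<^esub> x" if "x \<in> carrier Y" for x
    using smult_l_minus[OF carr that, of 1] neg smult_one[OF that] by simp
  have nrm_neg: "nrm Y (\<ominus> x) = nrm Y x" if "x \<in> carrier Y" for x
    using nrm_smult[OF that, of "-1"] neg_smult[OF that] by simp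
  have nonneg: "0 \<le> nrm Y x" if "x \<in> carrier Y" for x
    using nrm_triangle[of x "\<ominus> x"] that nrm_neg[OF that] nrm_eq_0_iff[of \<zero>]
    by (simp add: M.r_neg)
  have sym: "nrm Y (x \<ominus> y) = nrm Y (y \<ominus> x)" if "x \<in> carrier Y" "y \<in> carrier Y" for x y
    using nrm_neg[of "x \<ominus> y"] that by (simp add: a_minus_def M.minus_add M.a_comm)
  have tri: "nrm Y (x \<ominus> z) \<le> nrm Y (x \<ominus> y) + nrm Y (y \<ominus> z)"
    if "x \<in> carrier Y" "y \<in> carrier Y" "z \<in> carrier Y" for x y z
  proof -
    have "(x \<ominus> y) \<oplus> (y \<ominus> z) = x \<ominus> z"
      using that by (simp add: a_minus_def M.a_assoc M.r_neg1)
    then show ?thesis using nrm_triangle[of "x \<ominus> y" "y \<ominus> z"] that by simp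
  qed
  have eq0: "x \<ominus> y = \<zero> \<longleftrightarrow> x = y" if "x \<in> carrier Y" "y \<in> carrier Y" for x y
  proof
    assume "x \<ominus> y = \<zero>"
    moreover have "(x \<ominus> y) \<oplus> y = x"
      using that by (simp add: a_minus_def M.a_assoc M.l_neg)
    ultimately show "x = y" using that by simp
  qed (use that in \<open>simp add: a_minus_def M.r_neg\<close>)
  show ?thesis
    by unfold_locales
      (auto simp: ndist_def nonneg sym tri nrm_eq_0_iff eq0)
qed

definition order_of :: "('y, 'm) normed_order_structure_scheme \<Rightarrow> 'y gorder"
  where "order_of F = \<lparr>carrier = carrier F, eq = (=), le = leq F\<rparr>"

definition modulus :: "('y, 'm) normed_order_structure_scheme \<Rightarrow> 'y \<Rightarrow> 'y"
  where "modulus F x = join (order_of F) x (\<ominus>\<^bsub>F\<^esub> x)"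

locale banach_lattice_space = banach_space F + order: Lattice.lattice "order_of F"
  for F :: "('y, 'm) normed_order_structure_scheme" (structure) +
  assumes leq_add: "x \<in> carrier F \<Longrightarrow> y \<in> carrier F \<Longrightarrow> z \<in> carrier F \<Longrightarrow>
      leq F x y \<Longrightarrow> leq F (x \<oplus> z) (y \<oplus> z)"
    and leq_smult: "x \<in> carrier F \<Longrightarrow> y \<in> carrier F \<Longrightarrow> 0 \<le> a \<Longrightarrow>
      leq F x y \<Longrightarrow> leq F (a \<odot>\<^bsub>F\<^esub> x) (a \<odot>\<^bsub>F\<^esub> y)"
    and nrm_mono_modulus: "x \<in> carrier F \<Longrightarrow> y \<in> carrier F \<Longrightarrow>
      leq F (modulus F x) (modulus F y) \<Longrightarrow> nrm F x \<le> nrm F y"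

text \<open>A Banach lattice given by a type class instance, viewed as a codomain structure.\<close>

definition self :: "'a::banach_lattice normed_order_structure"
  where "self = \<lparr>carrier = UNIV, mult = undefined, one = undefined, ring.zero = 0, add = (+),
    smult = scaleR, nrm = norm, leq = (\<le>)\<rparr>"


text \<open>
  Nets are indexed by a directed subset of a type \<open>'i\<close>. The first argument \<open>TYPE('i)\<close> of the
  notions below fixes the type from which index sets are taken.
\<close>

definition directed_set :: "'i set \<Rightarrow> ('i \<times> 'i) set \<Rightarrow> bool"
  where "directed_set A r \<longleftrightarrow> A \<noteq> {} \<and> preorder_on A r \<and>
    (\<forall>a\<in>A. \<forall>b\<in>A. \<exists>c\<in>A. (a, c) \<in> r \<and> (b, c) \<in> r)"

definition tails :: "'i set \<Rightarrow> ('i \<times> 'i) set \<Rightarrow> 'i filter"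
  where "tails A r = (INF a\<in>A. principal {b \<in> A. (a, b) \<in> r})"

text \<open>Every net decreasing to infimum 0 tends to 0 in norm.\<close>

definition order_continuous_norm :: "'i itself \<Rightarrow> 'a::banach_lattice itself \<Rightarrow> bool"
  where "order_continuous_norm _ _ \<longleftrightarrow>
    (\<forall>(A :: 'i set) r (x :: 'i \<Rightarrow> 'a).
      directed_set A r \<and> monotone_on A (\<lambda>a b. (a, b) \<in> r) (\<ge>) x \<and>
      (\<forall>a\<in>A. 0 \<le> x a) \<and> (\<forall>z. (\<forall>a\<in>A. z \<le> x a) \<longrightarrow> z \<le> 0) \<longrightarrow>
      ((\<lambda>a. norm (x a)) \<longlongrightarrow> 0) (tails A r))"

definition KB_space :: "'a::banach_lattice itself \<Rightarrow> bool"
  where "KB_space _ \<longleftrightarrow>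
    (\<forall>x :: nat \<Rightarrow> 'a. (\<forall>n. 0 \<le> x n) \<and> incseq x \<and> bounded (range x) \<longrightarrow> convergent x)"

definition increasing_ball_net :: "'i set \<Rightarrow> ('i \<times> 'i) set \<Rightarrow> ('i \<Rightarrow> 'a::banach_lattice) \<Rightarrow> bool"
  where "increasing_ball_net A r x \<longleftrightarrow>
    directed_set A r \<and> monotone_on A (\<lambda>a b. (a, b) \<in> r) (\<le>) x \<and>
    (\<forall>a\<in>A. 0 \<le> x a \<and> norm (x a) \<le> 1)"

definition bounded_ops :: "('y, 'm) normed_structure_scheme \<Rightarrow> ('a::banach_lattice \<Rightarrow> 'y) set"
  where "bounded_ops Y = {T. range T \<subseteq> carrier Y \<and>
    (\<forall>x x'. T (x + x') = T x \<oplus>\<^bsub>Y\<^esub> T x') \<and>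
    (\<forall>c x. T (c *\<^sub>R x) = c \<odot>\<^bsub>Y\<^esub> T x) \<and>
    (\<exists>K. \<forall>x. nrm Y (T x) \<le> K * norm x)}"

definition compact_ops :: "('y, 'm) normed_structure_scheme \<Rightarrow> ('a::banach_lattice \<Rightarrow> 'y) set"
  where "compact_ops Y = {T \<in> bounded_ops Y.
    compactin (Metric_space.mtopology (carrier Y) (ndist Y))
      (Metric_space.mtopology (carrier Y) (ndist Y) closure_of (T ` cball 0 1))}"

definition KB_ops ::
    "'i itself \<Rightarrow> ('y, 'm) normed_structure_scheme \<Rightarrow> ('a::banach_lattice \<Rightarrow> 'y) set"
  where "KB_ops _ Y = {T \<in> bounded_ops Y.
    \<forall>(A :: 'i set) r x. increasing_ball_net A r x \<longrightarrow>
      (\<exists>x0. ((\<lambda>a. nrm Y (T (x a) \<ominus>\<^bsub>Y\<^esub> T x0)) \<longlongrightarrow> 0) (tails A r))}"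

definition qKB_ops ::
    "'i itself \<Rightarrow> ('y, 'm) normed_structure_scheme \<Rightarrow> ('a::banach_lattice \<Rightarrow> 'y) set"
  where "qKB_ops _ Y = {T \<in> bounded_ops Y.
    \<forall>(A :: 'i set) r x. increasing_ball_net A r x \<longrightarrow>
      (\<exists>y\<in>carrier Y. ((\<lambda>a. nrm Y (T (x a) \<ominus>\<^bsub>Y\<^esub> y)) \<longlongrightarrow> 0) (tails A r))}"

text \<open>For a class of operators \<open>C\<close>, its positive part is \<open>C \<inter> positive_maps F\<close>.\<close>

definition positive_maps ::
    "('y, 'm) normed_order_structure_scheme \<Rightarrow> ('a::banach_lattice \<Rightarrow> 'y) set"
  where "positive_maps F = {T. \<forall>x\<ge>0. leq F \<zero>\<^bsub>F\<^esub> (T x)}"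

lemma abelian_self: "abelian_group (self :: 'a::banach_lattice normed_order_structure)"
proof (rule abelian_groupI)
  show "\<exists>y\<in>carrier self. y \<oplus>\<^bsub>self\<^esub> x = \<zero>\<^bsub>self\<^esub>" for x :: 'a
    by (rule bexI[of _ "- x"]) (auto simp: self_def)
qed (auto simp: self_def ac_simps)

lemma minus_self: "\<ominus>\<^bsub>self\<^esub> x = - (x :: 'a::banach_lattice)"
proof -
  interpret abelian_group "self :: 'a normed_order_structure" by (rule abelian_self)
  show ?thesis by (rule minus_equality) (auto simp: self_def)
qed

lemma ndist_self: "ndist self = (dist :: 'a::banach_lattice \<Rightarrow> _)"
  by (intro ext) (simp add: ndist_def a_minus_def minus_self dist_norm, simp add: self_def)

lemma lattice_self: "Lattice.lattice (order_of (self :: 'a::banach_lattice normed_order_structure))"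
proof -
  interpret partial_order "order_of (self :: 'a normed_order_structure)"
    by unfold_locales (auto simp: order_of_def self_def)
  show ?thesis
  proof unfold_locales
    fix x y :: 'a
    show "\<exists>s. least (order_of self) s (Upper (order_of self) {x, y})"
      by (rule exI[of _ "sup x y"]) (auto simp: least_def Upper_def order_of_def self_def)
    show "\<exists>s. greatest (order_of self) s (Lower (order_of self) {x, y})"
      by (rule exI[of _ "inf x y"]) (auto simp: greatest_def Lower_def order_of_def self_def)
  qed
qed

lemma modulus_self: "modulus self x = \<bar>x :: 'a::banach_lattice\<bar>"
proof -
  interpret Lattice.lattice "order_of (self :: 'a normed_order_structure)"
    by (rule lattice_self)
  have "join (order_of self) x (- x) = sup x (- x)"
    by (rule joinI) (auto simp: least_def Upper_def order_of_def self_def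
        intro: least_unique)
  then show ?thesis by (simp add: modulus_def minus_self abs_lattice)
qed

lemma banach_lattice_space_self:
  "banach_lattice_space (self :: 'a::banach_lattice normed_order_structure)"
proof -
  have m: "module real_ring (self :: 'a normed_order_structure)"
    by (rule moduleI[OF cring_from_type_algebra abelian_self])
      (auto simp: self_def ring_of_type_algebra_def scaleR_add_left scaleR_add_right)
  have "banach_space (self :: 'a normed_order_structure)"
    using m unfolding banach_space_def banach_space_axioms_def ndist_self
    by (auto simp: self_def norm_triangle_ineq Met_TC.mcomplete_def)
  then show ?thesis
    using lattice_self
    unfolding banach_lattice_space_def banach_lattice_space_axioms_def modulus_self
    by (auto simp: self_def scaleR_left_mono norm_mono_abs)
qed

lemma bounded_ops_self: "bounded_ops self = {T :: 'a::banach_lattice \<Rightarrow> 'b::banach_lattice. bounded_linear T}"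
  by (auto simp: bounded_ops_def self_def bounded_linear_def linear_iff bounded_linear_axioms_def mult.commute)

lemma eventually_tails:
  assumes "directed_set A r"
  shows "eventually P (tails A r) \<longleftrightarrow> (\<exists>a\<in>A. \<forall>b\<in>A. (a, b) \<in> r \<longrightarrow> P b)"
proof -
  have tr: "trans r" and ne: "A \<noteq> {}"
    and dir: "\<And>a b. a \<in> A \<Longrightarrow> b \<in> A \<Longrightarrow> \<exists>c\<in>A. (a, c) \<in> r \<and> (b, c) \<in> r"
    using assms by (auto simp: directed_set_def preorder_on_def)
  show ?thesis
    unfolding tails_def
  proof (subst eventually_INF_base[OF ne])
    fix a b assume "a \<in> A" "b \<in> A"
    then obtain c where "c \<in> A" "(a, c) \<in> r" "(b, c) \<in> r" using dir by blast
    then show "\<exists>x\<in>A. principal {b \<in> A. (x, b) \<in> r}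
        \<le> inf (principal {b \<in> A. (a, b) \<in> r}) (principal {c \<in> A. (b, c) \<in> r})"
      using tr by (intro bexI[of _ c]) (auto dest: transD)
  qed (auto simp: eventually_principal)
qed

end

theory Submission
  imports Defs
begin

text \<open>
  In a KB-space every increasing net in the positive part of the ball converges in norm, so all five
  conditions hold. Conversely, let \<open>x\<close> be a norm bounded increasing sequence without a limit. Order
  continuity makes order bounded increasing sequences converge, and with it the increments of \<open>x\<close>
  can be disjointified: there are pairwise disjoint \<open>v k \<ge> 0\<close>, bounded away from zero in norm, each
  below some \<open>x m\<close>. By Hahn-Banach there are positive functionals \<open>f k\<close> of norm at most 1 with
  \<open>f k (v k) = \<parallel>v k\<parallel>\<close> that live on the bands generated by the \<open>v k\<close>; for every \<open>y\<close> the values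
  \<open>f k y\<close> accumulate at \<open>0\<close>. The operator \<open>T y = (\<Sum>k. 2\<^sup>-\<^sup>k f k y v k / \<parallel>v k\<parallel>)\<close> is positive and compact,
  hence quasi-KB. It is not KB: if \<open>T (x n)\<close> tends to \<open>T x0\<close>, then \<open>f k x0 = lim f k (x n)\<close> is
  bounded away from \<open>0\<close>. A copy of the lattice inside \<open>'a + 'u\<close> makes \<open>T\<close> a counterexample for the
  conditions that quantify over codomains.
\<close>

section \<open>Banach lattices and sublinear functionals\<close>

lemma norm_mono_nonneg:
  fixes x y :: "'a::banach_lattice"
  assumes "0 \<le> x" "x \<le> y" shows "norm x \<le> norm y"
  using assms by (intro norm_mono_abs) simp

lemma norm_abs_eq [simp]: "norm \<bar>x :: 'a::banach_lattice\<bar> = norm x"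
  by (intro antisym norm_mono_abs) simp_all

lemma norm_pprt_le: "norm (pprt x) \<le> norm (x :: 'a::banach_lattice)"
proof -
  have "norm (pprt x) \<le> norm \<bar>x\<bar>"
    by (rule norm_mono_nonneg) (auto simp: pprt_def abs_ge_self)
  then show ?thesis by simp
qed

lemma scaleR_inf_distrib:
  fixes x y :: "'a::banach_lattice"
  assumes "0 \<le> c" shows "c *\<^sub>R inf x y = inf (c *\<^sub>R x) (c *\<^sub>R y)"
proof (cases "c = 0")
  case False
  with assms have c: "0 < c" by simp
  show ?thesis
  proof (rule antisym)
    have "inverse c *\<^sub>R inf (c *\<^sub>R x) (c *\<^sub>R y) \<le> inf x y"
      using c scaleR_left_mono[of "inf (c *\<^sub>R x) (c *\<^sub>R y)" "c *\<^sub>R x" "inverse c"]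
        scaleR_left_mono[of "inf (c *\<^sub>R x) (c *\<^sub>R y)" "c *\<^sub>R y" "inverse c"] by simp
    from scaleR_left_mono[OF this assms] show "inf (c *\<^sub>R x) (c *\<^sub>R y) \<le> c *\<^sub>R inf x y"
      using c by simp
  qed (use assms in \<open>simp add: scaleR_left_mono\<close>)
qed simp

lemma scaleR_pprt:
  fixes x :: "'a::banach_lattice"
  assumes "0 \<le> c" shows "pprt (c *\<^sub>R x) = c *\<^sub>R pprt x"
proof -
  have "nprt (c *\<^sub>R (-x)) = c *\<^sub>R nprt (-x)"
    unfolding nprt_def using scaleR_inf_distrib[OF assms, of "-x" 0] by simp
  then show ?thesis by (simp add: nprt_neg)
qed

lemma pprt_add_le: "pprt (x + y) \<le> pprt x + pprt (y :: 'a::lattice_ab_group_add)"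
  unfolding pprt_def by (intro le_supI add_mono) (simp_all add: add_nonneg_nonneg)

text \<open>Distributing \<open>+\<close> over \<open>inf\<close> turns the right side into the
  infimum of the four sums \<open>x + y\<close>, \<open>z + y\<close>, \<open>x + z\<close> and
  \<open>z + z\<close>, each of which lies above the left side by positivity.\<close>

lemma inf_add_le:
  fixes x y z :: "'a::lattice_ab_group_add"
  assumes "0 \<le> x" "0 \<le> y" "0 \<le> z"
  shows "inf (x + y) z \<le> inf x z + inf y z"
proof -
  have "inf x z + inf y z = inf (inf (x + y) (z + y)) (inf (x + z) (z + z))"
    by (simp add: add_inf_distrib_left add_inf_distrib_right)
  moreover have "inf (x + y) z \<le> z + y" "inf (x + y) z \<le> x + z" "inf (x + y) z \<le> z + z"
    using assms by (auto intro: le_infI2 add_increasing add_increasing2)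
  ultimately show ?thesis by simp
qed

lemma diff_pprt_diff:
  fixes x z :: "'a::lattice_ab_group_add"
  shows "x - pprt (x - z) = inf x z"
proof -
  have "x - pprt (x - z) = x + inf (z - x) 0"
    by (simp add: pprt_def)
  also have "\<dots> = inf x z" by (simp add: add_inf_distrib_left inf_commute)
  finally show ?thesis .
qed

lemma inf_pprt_pprt_minus: "inf (pprt x) (pprt (-x :: 'a::lattice_ab_group_add)) = 0"
proof -
  have "inf (pprt x) (pprt (-x)) = inf (x - nprt x) (- nprt x)"
    using arg_cong[OF prts[of x], of "\<lambda>y. y - nprt x"] by (simp add: pprt_neg)
  also have "\<dots> = inf x 0 - nprt x"
    using add_inf_distrib_right[of x 0 "- nprt x"] by simp
  finally show ?thesis by (simp add: nprt_def)
qed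

text \<open>Closedness of the positive cone in quantitative form: \<open>pprt (x - y)\<close> lies
  below \<open>pprt (z - y)\<close>, whose norm is at most \<open>e\<close>, so it vanishes.\<close>

lemma le_if_approximable:
  fixes x y :: "'a::banach_lattice"
  assumes "\<And>e. 0 < e \<Longrightarrow> \<exists>z. x \<le> z \<and> norm (z - y) \<le> e"
  shows "x \<le> y"
proof -
  have "norm (pprt (x - y)) \<le> 0 + e" if e: "0 < e" for e
  proof -
    obtain z where z: "x \<le> z" "norm (z - y) \<le> e" using assms[OF e] by blast
    have "norm (pprt (x - y)) \<le> norm (pprt (z - y))"
      using z by (intro norm_mono_nonneg pprt_mono) auto
    also have "\<dots> \<le> e" using norm_pprt_le[of "z - y"] z by simp
    finally show ?thesis by simp
  qed
  then have "norm (pprt (x - y)) \<le> 0" by (rule field_le_epsilon)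
  then show ?thesis using le_zero_iff_zero_pprt[of "x - y"] by simp
qed

lemma LIMSEQ_ge_lower_bound:
  fixes x :: "nat \<Rightarrow> 'a::banach_lattice"
  assumes "x \<longlonglongrightarrow> l" "\<And>n. N \<le> n \<Longrightarrow> a \<le> x n"
  shows "a \<le> l"
proof (rule le_if_approximable)
  fix e :: real assume "0 < e"
  then obtain M where M: "\<And>n. M \<le> n \<Longrightarrow> norm (x n - l) < e"
    using assms(1) unfolding LIMSEQ_iff by blast
  show "\<exists>z. a \<le> z \<and> norm (z - l) \<le> e"
    using M[of "max M N"] assms(2)[of "max M N"] by (intro exI[of _ "x (max M N)"]) auto
qed

lemma LIMSEQ_le_upper_bound:
  fixes x :: "nat \<Rightarrow> 'a::banach_lattice"
  assumes "x \<longlonglongrightarrow> l" "\<And>n. N \<le> n \<Longrightarrow> x n \<le> a"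
  shows "l \<le> a"
  using LIMSEQ_ge_lower_bound[OF tendsto_minus[OF assms(1)], of N "-a"] assms(2) by simp

text \<open>Passing to positive parts bounds \<open>real n * norm (pprt z)\<close> by
  \<open>norm (pprt w)\<close> for every \<open>n\<close>.\<close>

lemma archimedean_le_zero:
  fixes z w :: "'a::banach_lattice"
  assumes "\<And>n::nat. real n *\<^sub>R z \<le> w"
  shows "z \<le> 0"
proof -
  have "norm (pprt z) \<le> 0"
  proof (rule ccontr)
    assume "\<not> norm (pprt z) \<le> 0"
    then obtain n where n: "norm (pprt w) < real n * norm (pprt z)"
      using reals_Archimedean3[of "norm (pprt z)"] by auto
    have "real n *\<^sub>R pprt z \<le> pprt w"
      using pprt_mono[OF assms[of n]] by (simp add: scaleR_pprt)
    then have "norm (real n *\<^sub>R pprt z) \<le> norm (pprt w)"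
      by (intro norm_mono_nonneg scaleR_nonneg_nonneg) auto
    with n show False by simp
  qed
  then show ?thesis using le_zero_iff_zero_pprt[of z] by simp
qed

section \<open>Sublinear functionals and the Hahn-Banach theorem\<close>

definition sublinear :: "('v::real_vector \<Rightarrow> real) \<Rightarrow> bool"
  where "sublinear p \<longleftrightarrow> (\<forall>x y. p (x + y) \<le> p x + p y) \<and> (\<forall>c x. 0 \<le> c \<longrightarrow> p (c *\<^sub>R x) = c * p x)"

lemma sublinear_zero: "sublinear p \<Longrightarrow> p 0 = 0"
  unfolding sublinear_def by (metis mult_zero_left order_refl scaleR_zero_left)

lemma sublinear_minus_le: "sublinear p \<Longrightarrow> - p (- x) \<le> p x"
  using sublinear_zero[of p] unfolding sublinear_def
  by (metis add.right_inverse add.commute diff_ge_0_iff_ge diff_minus_eq_add)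

text \<open>Subadditivity comes from directedness: a common lower bound \<open>s\<close> of
  \<open>q\<close> and \<open>r\<close> gives \<open>s (x + y) \<le> q x + r y\<close>, after which
  the infima over \<open>q\<close> and \<open>r\<close> can be taken separately.\<close>

lemma sublinear_Inf:
  assumes sub: "\<And>q. q \<in> C \<Longrightarrow> sublinear q" and ne: "C \<noteq> {}"
    and bdd: "\<And>x. bdd_below ((\<lambda>q. q x) ` C)"
    and dir: "\<And>q r. q \<in> C \<Longrightarrow> r \<in> C \<Longrightarrow> \<exists>s\<in>C. s \<le> q \<and> s \<le> r"
  shows "sublinear (\<lambda>x. INF q\<in>C. q x)"
  unfolding sublinear_def
proof (intro conjI allI impI)
  fix x y
  have "(INF q\<in>C. q (x + y)) - q x \<le> r y" if q: "q \<in> C" and r: "r \<in> C" for q r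
  proof -
    obtain s where s: "s \<in> C" "s \<le> q" "s \<le> r" using dir[OF q r] by blast
    have "(INF q\<in>C. q (x + y)) \<le> s (x + y)" by (rule cINF_lower[OF bdd s(1)])
    also have "\<dots> \<le> s x + s y" using sub[OF s(1)] by (simp add: sublinear_def)
    also have "\<dots> \<le> q x + r y" using s by (intro add_mono) (auto simp: le_fun_def)
    finally show ?thesis by simp
  qed
  then have "(INF q\<in>C. q (x + y)) - q x \<le> (INF r\<in>C. r y)" if "q \<in> C" for q
    using that ne by (intro cINF_greatest) auto
  then have "(INF q\<in>C. q (x + y)) - (INF r\<in>C. r y) \<le> q x" if "q \<in> C" for q
    using that by (simp add: algebra_simps)
  then have "(INF q\<in>C. q (x + y)) - (INF r\<in>C. r y) \<le> (INF q\<in>C. q x)"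
    using ne by (intro cINF_greatest)
  then show "(INF q\<in>C. q (x + y)) \<le> (INF q\<in>C. q x) + (INF r\<in>C. r y)" by simp
next
  fix c :: real and x assume c: "0 \<le> c"
  have hom: "q (c *\<^sub>R x) = c * q x" if "q \<in> C" for q
    using sub[OF that] c by (simp add: sublinear_def)
  have "(INF q\<in>C. q (c *\<^sub>R x)) = (INF q\<in>C. c * q x)"
    using hom by (intro INF_cong) auto
  also have "\<dots> = c * (INF q\<in>C. q x)"
  proof (cases "c = 0")
    case False
    show ?thesis
    proof (rule antisym)
      have "(INF q\<in>C. c * q x) / c \<le> q x" if "q \<in> C" for q
      proof -
        have "(INF q\<in>C. c * q x) \<le> c * q x"
          using bdd[of "c *\<^sub>R x"] hom that by (intro cINF_lower) (auto cong: image_cong)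
        with False c show ?thesis by (simp add: field_simps)
      qed
      then have "(INF q\<in>C. c * q x) / c \<le> (INF q\<in>C. q x)" using ne by (intro cINF_greatest)
      with False c show "(INF q\<in>C. c * q x) \<le> c * (INF q\<in>C. q x)" by (simp add: field_simps)
      show "c * (INF q\<in>C. q x) \<le> (INF q\<in>C. c * q x)"
        using ne c by (intro cINF_greatest mult_left_mono cINF_lower bdd) auto
    qed
  qed (use ne in simp)
  finally show "(INF q\<in>C. q (c *\<^sub>R x)) = c * (INF q\<in>C. q x)" .
qed

text \<open>The witness is the infimum over \<open>t \<ge> 0\<close> of
  \<open>p (x + t v) - t p v\<close>. It is finite since \<open>- p (- x)\<close> is a lower bound;
  \<open>t = 0\<close> gives \<open>q \<le> p\<close>, and \<open>t = 1\<close> gives the value at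
  \<open>- v\<close>. Thus \<open>p\<close> can be lowered strictly whenever it fails to be odd at
  \<open>v\<close>.\<close>

lemma sublinear_reduce:
  assumes p: "sublinear p"
  obtains q where "sublinear q" "q \<le> p" "q (- v) \<le> - p v"
proof -
  have add: "p (x + y) \<le> p x + p y" and hom: "0 \<le> c \<Longrightarrow> p (c *\<^sub>R x) = c * p x" for x y c
    using p by (auto simp: sublinear_def)
  define g where "g x t = p (x + t *\<^sub>R v) - t * p v" for x t
  define q where "q x = (INF t\<in>{0..}. g x t)" for x
  have bdd: "bdd_below (g x ` {0..})" for x
  proof (rule bdd_belowI2)
    fix t :: real assume "t \<in> {0..}"
    then have "t * p v \<le> p (x + t *\<^sub>R v) + p (- x)"
      using add[of "x + t *\<^sub>R v" "- x"] hom[of t v] by simp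
    then show "- p (- x) \<le> g x t" by (simp add: g_def)
  qed
  have greatest: "l \<le> q x" if "\<And>t. 0 \<le> t \<Longrightarrow> l \<le> g x t" for l x
    unfolding q_def using that by (intro cINF_greatest) auto
  have low: "q x \<le> g x t" if "0 \<le> t" for x t
    unfolding q_def using that by (intro cINF_lower bdd) auto
  have "sublinear q"
    unfolding sublinear_def
  proof (intro conjI allI impI)
    fix x y
    have "q (x + y) \<le> g x s + g y t" if "0 \<le> s" "0 \<le> t" for s t
      using low[of "s + t" "x + y"] add[of "x + s *\<^sub>R v" "y + t *\<^sub>R v"] that
      by (simp add: g_def algebra_simps)
    then have "q (x + y) - g x s \<le> q y" if "0 \<le> s" for s
      using that by (intro greatest) (auto simp: diff_le_eq add.commute)
    then have "q (x + y) - q y \<le> q x"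
      by (intro greatest) (auto simp: diff_le_eq add.commute)
    then show "q (x + y) \<le> q x + q y" by simp
  next
    fix c :: real and x assume c: "0 \<le> c"
    show "q (c *\<^sub>R x) = c * q x"
    proof (cases "c = 0")
      case True
      have "q 0 = 0"
      proof (rule antisym)
        show "q 0 \<le> 0" using low[of 0 0] sublinear_zero[OF p] by (simp add: g_def)
        show "0 \<le> q 0" by (intro greatest) (simp add: g_def hom)
      qed
      with True show ?thesis by simp
    next
      case False
      with c have c: "0 < c" by simp
      \<comment> \<open>For \<open>c > 0\<close> the map from \<open>t\<close> to
        \<open>c * t\<close> permutes the half-line, so this scaling of \<open>g\<close> carries
        over to its infimum \<open>q\<close>.\<close>
      have g: "g (c *\<^sub>R x) (c * t) = c * g x t" for t
        using hom[of c "x + t *\<^sub>R v"] c by (simp add: g_def algebra_simps)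
      show ?thesis
      proof (rule antisym)
        have "q (c *\<^sub>R x) / c \<le> g x t" if "0 \<le> t" for t
          using low[of "c * t" "c *\<^sub>R x"] c that g[of t] by (simp add: pos_divide_le_eq mult.commute)
        then have "q (c *\<^sub>R x) / c \<le> q x" by (intro greatest)
        then show "q (c *\<^sub>R x) \<le> c * q x" using c by (simp add: pos_divide_le_eq mult.commute)
        have "c * q x \<le> g (c *\<^sub>R x) t" if "0 \<le> t" for t
          using low[of "t / c" x] c that g[of "t / c"] by (simp add: mult_left_mono)
        then show "c * q x \<le> q (c *\<^sub>R x)" by (intro greatest)
      qed
    qed
  qed
  moreover have "q \<le> p" using low[of 0] by (simp add: le_fun_def g_def)
  moreover have "q (- v) \<le> - p v"
    using low[of 1 "- v"] sublinear_zero[OF p] by (simp add: g_def)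
  ultimately show thesis by (rule that)
qed

text \<open>Zorn's lemma for the reversed pointwise order. A nonempty chain is bounded by its
  pointwise infimum, which is finite because every sublinear \<open>q \<le> p\<close> satisfies
  \<open>- p (- x) \<le> q x\<close>.\<close>

lemma minimal_sublinear:
  assumes p: "sublinear p"
  obtains q where "sublinear q" "q \<le> p" "\<And>r. sublinear r \<Longrightarrow> r \<le> q \<Longrightarrow> r = q"
proof -
  let ?A = "{q. sublinear q \<and> q \<le> p}"
  have "\<exists>m\<in>?A. \<forall>a\<in>?A. a \<le> m \<longrightarrow> a = m"
  proof (rule predicate_Zorn[of ?A "\<lambda>q r. r \<le> q"])
    show "partial_order_on ?A (relation_of (\<lambda>q r. r \<le> q) ?A)"
      by (rule partial_order_on_relation_ofI) auto
    fix C assume "C \<in> Chains (relation_of (\<lambda>q r. r \<le> q) ?A)"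
    then have C: "C \<subseteq> ?A" and tot: "\<And>q r. q \<in> C \<Longrightarrow> r \<in> C \<Longrightarrow> q \<le> r \<or> r \<le> q"
      by (auto simp: Chains_def relation_of_def)
    show "\<exists>u\<in>?A. \<forall>a\<in>C. u \<le> a"
    proof (cases "C = {}")
      case False
      have bdd: "bdd_below ((\<lambda>q. q x) ` C)" for x
      proof (rule bdd_belowI2)
        fix q assume "q \<in> C"
        then have q: "sublinear q" "q \<le> p" using C by auto
        from q(2) have "q (-x) \<le> p (-x)" by (rule le_funD)
        with sublinear_minus_le[OF q(1), of x] show "- p (- x) \<le> q x" by linarith
      qed
      let ?u = "\<lambda>x. INF q\<in>C. q x"
      have "sublinear ?u"
        by (rule sublinear_Inf[OF _ False bdd]) (use C tot in blast)+
      moreover have low: "?u \<le> q" if "q \<in> C" for q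
        using cINF_lower[OF bdd that] by (simp add: le_fun_def)
      moreover have "?u \<le> p"
      proof -
        obtain q where "q \<in> C" using False by blast
        then show ?thesis using low C by force
      qed
      ultimately show ?thesis by blast
    qed (use p in auto)
  qed
  then obtain m where m: "sublinear m" "m \<le> p"
    and min: "\<And>a. sublinear a \<Longrightarrow> a \<le> p \<Longrightarrow> a \<le> m \<Longrightarrow> a = m" by blast
  show thesis
    by (rule that[OF m]) (use min m(2) in \<open>auto intro: order_trans\<close>)
qed

text \<open>A minimal sublinear functional below \<open>p\<close> is linear, since it cannot be reduced any further.\<close>

theorem hahn_banach_sublinear:
  fixes p :: "'v::real_vector \<Rightarrow> real"
  assumes p: "sublinear p"
  obtains f where "linear f" "\<And>x. f x \<le> p x" "f v = p v"
proof -
  \<comment> \<open>Reducing at \<open>v\<close> first forces \<open>f (- v) \<le> - p v\<close> for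
    every \<open>f\<close> below \<open>p'\<close>; for linear \<open>f\<close> this reads
    \<open>p v \<le> f v\<close>.\<close>
  obtain p' where p': "sublinear p'" "p' \<le> p" "p' (- v) \<le> - p v"
    using sublinear_reduce[OF p] by blast
  obtain f where f: "sublinear f" "f \<le> p'" and min: "\<And>r. sublinear r \<Longrightarrow> r \<le> f \<Longrightarrow> r = f"
    using minimal_sublinear[OF p'(1)] by blast
  have neg: "f (- x) = - f x" for x
  proof -
    obtain r where "sublinear r" "r \<le> f" "r (- x) \<le> - f x"
      using sublinear_reduce[OF f(1)] by blast
    with min sublinear_minus_le[OF f(1), of "- x"] show ?thesis by force
  qed
  have add: "f (x + y) \<le> f x + f y" and hom: "0 \<le> c \<Longrightarrow> f (c *\<^sub>R x) = c * f x" for x y c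
    using f(1) by (auto simp: sublinear_def)
  have "f (x + y) = f x + f y" for x y
    using add[of x y] add[of "x + y" "- y"] neg[of y] by simp
  moreover have "f (c *\<^sub>R x) = c *\<^sub>R f x" for c x
    using hom[of c x] hom[of "- c" x] neg[of "c *\<^sub>R x"] by (cases "0 \<le> c") auto
  ultimately have "linear f" by (rule linearI)
  moreover have le: "f x \<le> p x" for x
    using f(2) p'(2) by (meson le_funD order_trans)
  moreover have "f v = p v"
    using le[of v] le_funD[OF f(2), of "- v"] p'(3) neg[of v] by simp
  ultimately show thesis by (rule that)
qed

section \<open>Disjoint minorants of a divergent increasing sequence\<close>

text \<open>The sequential consequence of an order continuous norm on which the construction of the
  operator rests; it mentions no index type.\<close>

definition order_bounded_convergent :: "'a::banach_lattice itself \<Rightarrow> bool"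
  where "order_bounded_convergent _ \<longleftrightarrow>
    (\<forall>(x :: nat \<Rightarrow> 'a) y. incseq x \<and> (\<forall>n. x n \<le> y) \<longrightarrow> convergent x)"

text \<open>A downward directed set is a net indexed by itself under the reversed order;
  \<open>Inl\<close> places it in the index universe \<open>'a + 'u\<close>.\<close>

lemma order_continuous_norm_downward:
  fixes D :: "'a::banach_lattice set"
  assumes oc: "order_continuous_norm TYPE('a + 'u) TYPE('a)"
    and D: "D \<noteq> {}" "\<And>d e. d \<in> D \<Longrightarrow> e \<in> D \<Longrightarrow> \<exists>c\<in>D. c \<le> d \<and> c \<le> e" "\<And>d. d \<in> D \<Longrightarrow> 0 \<le> d"
    and inf0: "\<And>z. (\<And>d. d \<in> D \<Longrightarrow> z \<le> d) \<Longrightarrow> z \<le> 0" and e: "0 < e"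
  shows "\<exists>d\<in>D. norm d < e"
proof -
  let ?A = "Inl ` D :: ('a + 'u) set"
  let ?r = "{(Inl p, Inl q) | p q. p \<in> D \<and> q \<in> D \<and> q \<le> p} :: (('a + 'u) \<times> ('a + 'u)) set"
  have dir: "directed_set ?A ?r"
    unfolding directed_set_def preorder_on_def
  proof (intro conjI ballI)
    fix a b assume "a \<in> ?A" "b \<in> ?A"
    then obtain p q where "a = Inl p" "b = Inl q" "p \<in> D" "q \<in> D" by blast
    then show "\<exists>c\<in>?A. (a, c) \<in> ?r \<and> (b, c) \<in> ?r"
      using D(2)[of p q] by blast
  qed (use D(1) in \<open>auto simp: refl_on_def trans_def\<close>)
  have "((\<lambda>a. norm (projl a)) \<longlongrightarrow> 0) (tails ?A ?r)"
    using oc dir unfolding order_continuous_norm_def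
    by (elim allE[of _ ?A] allE[of _ ?r] allE[of _ projl])
      (use D(3) inf0 in \<open>auto simp: monotone_on_def\<close>)
  then have "eventually (\<lambda>a. norm (projl a) < e) (tails ?A ?r)"
    using e by (auto dest!: order_tendstoD(2))
  then show ?thesis
    unfolding eventually_tails[OF dir] by force
qed

text \<open>In place of a supremum of \<open>x\<close>, all differences \<open>u - x n\<close> of
  upper bounds and terms are considered. They are directed downwards with infimum 0, so some
  \<open>u - x N\<close> is small in norm, and it dominates \<open>x n - x N\<close> for all later
  \<open>n\<close>.\<close>

lemma order_continuous_norm_imp_convergent:
  assumes oc: "order_continuous_norm TYPE('a + 'u) TYPE('a::banach_lattice)"
  shows "order_bounded_convergent TYPE('a)"
  unfolding order_bounded_convergent_def
proof (intro allI impI)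
  fix x :: "nat \<Rightarrow> 'a" and y assume "incseq x \<and> (\<forall>n. x n \<le> y)"
  then have x: "incseq x" and y: "\<And>n. x n \<le> y" by auto
  let ?D = "{u - x n | u n. \<forall>m. x m \<le> u}"
  have "Cauchy x"
  proof (rule metric_CauchyI)
    fix e :: real assume e: "0 < e"
    have "\<exists>d\<in>?D. norm d < e / 2"
    proof (rule order_continuous_norm_downward[OF oc])
      show "?D \<noteq> {}" using y by blast
    next
      fix d d' assume "d \<in> ?D" "d' \<in> ?D"
      then obtain u n u' n' where d: "d = u - x n" "\<And>m. x m \<le> u"
        and d': "d' = u' - x n'" "\<And>m. x m \<le> u'" by blast
      have "inf u u' - x (max n n') \<le> d" "inf u u' - x (max n n') \<le> d'"
        using d(1) d'(1) x by (auto intro!: diff_mono incseqD[of x])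
      moreover have "inf u u' - x (max n n') \<in> ?D" using d(2) d'(2) by auto
      ultimately show "\<exists>c\<in>?D. c \<le> d \<and> c \<le> d'" by blast
    next
      fix d assume "d \<in> ?D" then show "0 \<le> d" by auto
    next
      fix z assume z: "\<And>d. d \<in> ?D \<Longrightarrow> z \<le> d"
      \<comment> \<open>If \<open>u\<close> is an upper bound of \<open>x\<close>, then
        \<open>z \<le> u - x m\<close> for all \<open>m\<close> makes \<open>u - z\<close> another
        one. Iteration from \<open>y\<close> puts all multiples of \<open>z\<close> below
        \<open>y - x 0\<close>.\<close>
      have shift: "x m \<le> y - real k *\<^sub>R z" for k m
      proof (induction k arbitrary: m)
        case (Suc k)
        have "z \<le> (y - real k *\<^sub>R z) - x m" using Suc by (intro z) blast
        then show ?case by (simp add: algebra_simps)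
      qed (use y in simp)
      have "real k *\<^sub>R z \<le> y - x 0" for k
        using shift[of 0 k] by (simp add: algebra_simps)
      then show "z \<le> 0" by (rule archimedean_le_zero)
    qed (use e in simp)
    then obtain u N where u: "\<And>m. x m \<le> u" "norm (u - x N) < e / 2" by blast
    have "norm (x n - x N) < e / 2" if "N \<le> n" for n
    proof -
      have "norm (x n - x N) \<le> norm (u - x N)"
        using u(1) incseqD[OF x that] by (intro norm_mono_nonneg) auto
      with u(2) show ?thesis by simp
    qed
    then show "\<exists>M. \<forall>m\<ge>M. \<forall>n\<ge>M. dist (x m) (x n) < e"
      by (intro exI[of _ N] allI impI) (metis dist_norm dist_triangle_half_l)
  qed
  then show "convergent x" by (simp add: Cauchy_convergent_iff)
qed

text \<open>For fixed \<open>N\<close> the truncations \<open>y N m\<close> increase in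
  \<open>m\<close> below \<open>z\<close> and have a limit \<open>h N\<close>; the
  \<open>h N\<close> decrease to a limit \<open>g\<close>. Once \<open>g = 0\<close> is known, a
  small \<open>h N\<close> dominates all later truncated increments.\<close>

lemma inf_tail_increments_small:
  fixes x :: "nat \<Rightarrow> 'a::banach_lattice"
  assumes obc: "order_bounded_convergent TYPE('a)"
    and x: "incseq x" "\<And>n. norm (x n) \<le> M" and z: "0 \<le> z" and e: "0 < e"
  shows "\<exists>N. \<forall>n\<ge>N. \<forall>m\<ge>n. norm (inf z (x m - x n)) \<le> e"
proof -
  define y where "y N m = inf z (x m - x N)" for N m
  have y_mono: "y N' m \<le> y N m'" if "N \<le> N'" "m \<le> m'" for N N' m m'
    unfolding y_def using that x(1) by (intro inf_mono diff_mono incseqD[of x]) auto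
  have "convergent (y N)" for N
    using obc y_mono[of N N] unfolding order_bounded_convergent_def
    by (elim allE[of _ "y N"] allE[of _ z]) (auto simp: incseq_def y_def)
  then obtain h where h: "\<And>N. y N \<longlonglongrightarrow> h N"
    unfolding convergent_def by metis
  have y_le: "y N m \<le> h N" for N m
    by (rule LIMSEQ_ge_lower_bound[OF h, of m]) (simp add: y_mono)
  have h_nonneg: "0 \<le> h N" for N
    by (rule LIMSEQ_ge_lower_bound[OF h, of N]) (use z x(1) in \<open>auto simp: y_def incseq_def\<close>)
  have h_anti: "h N' \<le> h N" if "N \<le> N'" for N N'
    by (rule LIMSEQ_le_upper_bound[OF h]) (rule order_trans[OF y_mono[OF that order_refl] y_le])
  have "convergent (\<lambda>N. - h N)"
    using obc h_anti h_nonneg unfolding order_bounded_convergent_def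
    by (elim allE[of _ "\<lambda>N. - h N"] allE[of _ 0]) (auto simp: incseq_def)
  then obtain g where g: "h \<longlonglongrightarrow> g"
    unfolding convergent_def using tendsto_minus_cancel_left by blast
  have g_le: "g \<le> h N" for N
    by (rule LIMSEQ_le_upper_bound[OF g, of N]) (rule h_anti)
  have g_nonneg: "0 \<le> g"
    by (rule LIMSEQ_ge_lower_bound[OF g, of 0]) (rule h_nonneg)
  \<comment> \<open>The limit \<open>g\<close> fits below every tail increment, so arbitrarily many copies of it fit below
    successive increments of the norm bounded sequence; this forces \<open>g = 0\<close>.\<close>
  have many: "\<exists>m0. \<forall>m\<ge>m0. norm (pprt (real J *\<^sub>R g - (x m - x N))) \<le> e" if "0 < e" for J N e
    using that
  proof (induction J arbitrary: e)
    case 0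
    have "pprt (- (x m - x N)) = 0" if "N \<le> m" for m
      using incseqD[OF x(1) that] by (intro pprt_eq_0) simp
    then show ?case using 0 by (intro exI[of _ N]) simp
  next
    case (Suc J)
    \<comment> \<open>Up to \<open>e / 2\<close>, \<open>J\<close> copies of \<open>g\<close> fit
      below \<open>x p - x N\<close>. For \<open>m \<ge> q\<close> one more copy fits below
      \<open>x m - x p\<close> up to \<open>e / 2\<close>, since \<open>g \<le> h p\<close> and
      \<open>h p\<close> is close to \<open>y p m \<le> x m - x p\<close>.\<close>
    then obtain p where p: "norm (pprt (real J *\<^sub>R g - (x p - x N))) \<le> e / 2"
      by (meson half_gt_zero order_refl)
    obtain q where q: "\<And>m. q \<le> m \<Longrightarrow> norm (y p m - h p) < e / 2"
      using h[of p] Suc.prems unfolding LIMSEQ_iff by (meson half_gt_zero)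
    show ?case
    proof (intro exI[of _ q] allI impI)
      fix m assume "q \<le> m"
      have "pprt (real (Suc J) *\<^sub>R g - (x m - x N))
          = pprt ((real J *\<^sub>R g - (x p - x N)) + (g - (x m - x p)))"
        by (simp add: algebra_simps)
      also have "\<dots> \<le> pprt (real J *\<^sub>R g - (x p - x N)) + pprt (g - (x m - x p))"
        by (rule pprt_add_le)
      also have "\<dots> \<le> pprt (real J *\<^sub>R g - (x p - x N)) + pprt (h p - y p m)"
        using g_le by (intro add_left_mono pprt_mono diff_mono) (auto simp: y_def)
      finally have "norm (pprt (real (Suc J) *\<^sub>R g - (x m - x N)))
          \<le> norm (pprt (real J *\<^sub>R g - (x p - x N)) + pprt (h p - y p m))"
        by (intro norm_mono_nonneg) auto
      also have "\<dots> \<le> e / 2 + e / 2"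
        using p norm_pprt_le[of "h p - y p m"] q[OF \<open>q \<le> m\<close>] norm_triangle_ineq
        by (smt (verit) norm_minus_commute)
      finally show "norm (pprt (real (Suc J) *\<^sub>R g - (x m - x N))) \<le> e" by simp
    qed
  qed
  have "real J * norm g \<le> 1 + 2 * M" for J
  proof -
    obtain m where m: "norm (pprt (real J *\<^sub>R g - (x m - x 0))) \<le> 1"
      using many[of 1 J 0] by auto
    have "real J *\<^sub>R g \<le> pprt (real J *\<^sub>R g)" by (simp add: pprt_def)
    also have "\<dots> \<le> pprt (real J *\<^sub>R g - (x m - x 0)) + pprt (x m - x 0)"
      using pprt_add_le[of "real J *\<^sub>R g - (x m - x 0)" "x m - x 0"] by simp
    finally have "norm (real J *\<^sub>R g)
        \<le> norm (pprt (real J *\<^sub>R g - (x m - x 0)) + pprt (x m - x 0))"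
      using g_nonneg by (intro norm_mono_nonneg scaleR_nonneg_nonneg) auto
    also have "\<dots> \<le> norm (pprt (real J *\<^sub>R g - (x m - x 0))) + norm (pprt (x m - x 0))"
      by (rule norm_triangle_ineq)
    also have "\<dots> \<le> 1 + 2 * M"
      using m norm_pprt_le[of "x m - x 0"] norm_triangle_ineq4[of "x m" "x 0"] x(2)[of m] x(2)[of 0]
      by linarith
    finally show ?thesis by simp
  qed
  then have "g = 0"
    using reals_Archimedean3[of "norm g"] by (meson not_less zero_less_norm_iff)
  then obtain N where N: "norm (h N) < e"
    using g e unfolding LIMSEQ_iff by fastforce
  show ?thesis
  proof (intro exI[of _ N] allI impI)
    fix n m assume nm: "N \<le> n" "n \<le> m"
    have "norm (inf z (x m - x n)) \<le> norm (h N)"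
    proof (rule norm_mono_nonneg)
      show "0 \<le> inf z (x m - x n)" using z incseqD[OF x(1) nm(2)] by simp
      show "inf z (x m - x n) \<le> h N"
        using order_trans[OF y_mono[OF nm(1) order_refl, of m] y_le[of N m]] unfolding y_def .
    qed
    with N show "norm (inf z (x m - x n)) \<le> e" by simp
  qed
qed

text \<open>Two terms at distance at least \<open>e\<close> cannot both be closer than
  \<open>e / 2\<close> to \<open>x N\<close>, so half of a Cauchy gap can be measured from
  \<open>x N\<close> itself.\<close>

lemma not_convergent_gap:
  fixes x :: "nat \<Rightarrow> 'a::banach"
  assumes "\<not> convergent x"
  obtains \<delta> where "0 < \<delta>" "\<And>N. \<exists>m\<ge>N. \<delta> \<le> norm (x m - x N)"
proof -
  have "\<not> Cauchy x" using assms by (simp add: Cauchy_convergent_iff)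
  then obtain e where e: "0 < e" "\<And>N. \<exists>m\<ge>N. \<exists>n\<ge>N. e \<le> dist (x m) (x n)"
    unfolding Cauchy_def by (meson not_less)
  have "\<exists>m\<ge>N. e / 2 \<le> norm (x m - x N)" for N
  proof -
    obtain m n where "N \<le> m" "N \<le> n" "e \<le> dist (x m) (x n)" using e(2) by blast
    then show ?thesis
      using dist_triangle_half_l[of "x m" "x N" e "x n"] by (fastforce simp: dist_norm)
  qed
  with e(1) show thesis using that[of "e / 2"] by simp
qed

text \<open>Disjointification by trimming: increments \<open>u k\<close> are chosen nearly disjoint
  from a large multiple of their predecessors, and the remaining overlaps are cut off at a loss of
  norm that is eventually below \<open>\<delta> / 2\<close>.\<close>

theorem disjoint_minorants:
  fixes x :: "nat \<Rightarrow> 'a::banach_lattice"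
  assumes obc: "order_bounded_convergent TYPE('a)"
    and x: "incseq x" "\<And>n. 0 \<le> x n" "\<And>n. norm (x n) \<le> M" and nc: "\<not> convergent x"
  shows "\<exists>(v :: nat \<Rightarrow> 'a) \<delta>. 0 < \<delta> \<and> (\<forall>k. 0 \<le> v k \<and> \<delta> \<le> norm (v k) \<and> (\<exists>m. v k \<le> x m)) \<and>
    (\<forall>i k. i \<noteq> k \<longrightarrow> inf (v i) (v k) = 0)"
proof -
  obtain \<delta> where \<delta>: "0 < \<delta>" "\<And>N. \<exists>m\<ge>N. \<delta> \<le> norm (x m - x N)"
    using not_convergent_gap[OF nc] by blast
  \<comment> \<open>Here \<open>s\<close> stands for the sum of the increments chosen before; it
    dominates each of them, so one condition controls all overlaps.\<close>
  define good where "good k s u \<longleftrightarrow> (\<exists>a b. a \<le> b \<and> u = x b - x a) \<and> \<delta> \<le> norm u \<and>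
    norm (inf (4 ^ k *\<^sub>R s) u) \<le> \<delta> / 4" for k :: nat and s u
  have good_ex: "\<exists>u. good k s u" if s: "0 \<le> s" for k s
  proof -
    obtain N where N: "\<And>n m. N \<le> n \<Longrightarrow> n \<le> m \<Longrightarrow> norm (inf (4 ^ k *\<^sub>R s) (x m - x n)) \<le> \<delta> / 4"
      using inf_tail_increments_small[OF obc x(1,3), of "4 ^ k *\<^sub>R s" "\<delta> / 4"] \<delta>(1) s
      by (auto simp: scaleR_nonneg_nonneg)
    obtain m where "N \<le> m" "\<delta> \<le> norm (x m - x N)" using \<delta>(2) by blast
    with N[of N m] show ?thesis by (auto simp: good_def)
  qed
  have good_nonneg: "0 \<le> u" if "good k s u" for k s u
    using that incseqD[OF x(1)] by (auto simp: good_def)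
  \<comment> \<open>Dependent choice runs over pairs of the sum so far and the next
    increment.\<close>
  have "\<exists>f. \<forall>k. (0 \<le> fst (f k) \<and> good k (fst (f k)) (snd (f k))) \<and>
      fst (f (Suc k)) = fst (f k) + snd (f k)"
  proof (rule dependent_nat_choice)
    show "\<exists>p. 0 \<le> fst p \<and> good 0 (fst p) (snd p)" using good_ex[of 0 0] by auto
    fix p :: "'a \<times> 'a" and k assume p: "0 \<le> fst p \<and> good k (fst p) (snd p)"
    then have "0 \<le> fst p + snd p" using good_nonneg by (blast intro: add_nonneg_nonneg)
    then show "\<exists>q. (0 \<le> fst q \<and> good (Suc k) (fst q) (snd q)) \<and> fst q = fst p + snd p"
      using good_ex[of "fst p + snd p" "Suc k"] by auto
  qed
  then obtain f where f: "\<And>k. 0 \<le> fst (f k)" "\<And>k. good k (fst (f k)) (snd (f k))"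
    "\<And>k. fst (f (Suc k)) = fst (f k) + snd (f k)" by blast
  define s where "s k = fst (f k)" for k
  define u where "u k = snd (f k)" for k
  have s_nonneg: "0 \<le> s k" and s_Suc: "s (Suc k) = s k + u k" and good: "good k (s k) (u k)" for k
    using f by (auto simp: s_def u_def)
  have u_nonneg: "0 \<le> u k" for k using good good_nonneg by blast
  have u_le_s: "u i \<le> s k" if "i < k" for i k
    using that
  proof (induction k)
    case (Suc k)
    then show ?case using s_nonneg u_nonneg unfolding s_Suc
      by (cases "i = k") (auto simp: less_Suc_eq intro: add_increasing add_increasing2)
  qed simp
  have u_norm: "norm (u k) \<le> 2 * M" for k
  proof -
    obtain a b where "u k = x b - x a" using good[of k] by (auto simp: good_def)
    then show ?thesis
      using norm_triangle_ineq4[of "x b" "x a"] x(3)[of a] x(3)[of b] by simp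
  qed
  \<comment> \<open>The weights make the series converge, as the \<open>u k\<close> are norm
    bounded. Its sum \<open>w\<close> dominates every \<open>t k\<close>, and so controls all later
    increments at once.\<close>
  define t where "t k = (1 / 2) ^ k *\<^sub>R u k" for k
  define w where "w = suminf t"
  have "summable t"
  proof (rule summable_comparison_test')
    show "summable (\<lambda>k. 2 * M * (1 / 2) ^ k)" by (intro summable_mult summable_geometric) simp
    show "norm (t k) \<le> 2 * M * (1 / 2) ^ k" if "0 \<le> k" for k
      using mult_right_mono[OF u_norm, of "(1 / 2) ^ k" k] by (simp add: t_def mult.commute)
  qed
  then have sums: "(\<lambda>n. \<Sum>k<n. t k) \<longlonglongrightarrow> w" by (simp add: w_def summable_LIMSEQ)
  have t_nonneg: "0 \<le> t k" for k by (simp add: t_def u_nonneg scaleR_nonneg_nonneg)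
  have t_le: "t k \<le> w" for k
  proof (rule LIMSEQ_ge_lower_bound[OF sums, of "Suc k"])
    fix n assume "Suc k \<le> n"
    then show "t k \<le> (\<Sum>i<n. t i)"
      using sum_mono2[of "{..<n}" "{k}" t] t_nonneg by simp
  qed
  have w_nonneg: "0 \<le> w" using t_nonneg[of 0] t_le[of 0] by (rule order_trans)
  \<comment> \<open>Subtracting \<open>4\<^sup>k s k\<close> makes \<open>v k\<close> disjoint from the earlier terms, subtracting \<open>2\<^sup>-\<^sup>k w\<close> from the
    later ones.\<close>
  define v where "v k = pprt (u k - (4 ^ k *\<^sub>R s k + (1 / 2) ^ k *\<^sub>R w))" for k
  have disj: "inf (v i) (v k) = 0" if ik: "i < k" for i k
  proof -
    \<comment> \<open>\<open>v k\<close> lies below the positive part of \<open>?a\<close> and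
      \<open>v i\<close> below the positive part of \<open>- ?a\<close>; these two parts are
      disjoint.\<close>
    let ?a = "u k - 4 ^ k *\<^sub>R u i"
    have "v k \<le> pprt ?a"
      unfolding v_def using u_le_s[OF ik] w_nonneg
      by (intro pprt_mono diff_left_mono) (simp add: add_increasing2 scaleR_left_mono scaleR_nonneg_nonneg)
    moreover have "v i \<le> pprt (- ?a)"
    proof -
      \<comment> \<open>By \<open>i < k\<close>, the term \<open>(1 / 2) ^ i w\<close> subtracted in
        \<open>v i\<close> dominates \<open>(1 / 4) ^ k u k\<close>, and
        \<open>u i - (1 / 4) ^ k u k\<close> is a positive multiple of \<open>- ?a\<close>.\<close>
      have "(1 / 4) ^ k \<le> (1 / 2 :: real) ^ (i + k)"
      proof -
        have "(1 / 4 :: real) ^ k = (1 / 2) ^ (k + k)"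
          by (simp add: power_add flip: power_mult_distrib)
        also have "\<dots> \<le> (1 / 2) ^ (i + k)" using ik by (intro power_decreasing) auto
        finally show ?thesis .
      qed
      then have "(1 / 4) ^ k *\<^sub>R u k \<le> (1 / 2) ^ (i + k) *\<^sub>R u k"
        by (intro scaleR_right_mono u_nonneg)
      also have "\<dots> = (1 / 2) ^ i *\<^sub>R t k" by (simp add: t_def power_add)
      also have "\<dots> \<le> (1 / 2) ^ i *\<^sub>R w" by (intro scaleR_left_mono t_le) simp
      finally have "u i - (4 ^ i *\<^sub>R s i + (1 / 2) ^ i *\<^sub>R w) \<le> u i - (1 / 4) ^ k *\<^sub>R u k"
        using s_nonneg[of i] by (intro diff_left_mono) (simp add: add_increasing scaleR_nonneg_nonneg)
      also have "\<dots> = (1 / 4) ^ k *\<^sub>R (- ?a)"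
        by (simp add: scaleR_diff_right flip: power_mult_distrib)
      finally have "v i \<le> (1 / 4) ^ k *\<^sub>R pprt (- ?a)"
        unfolding v_def by (subst scaleR_pprt[symmetric]) (auto intro: pprt_mono)
      also have "\<dots> \<le> 1 *\<^sub>R pprt (- ?a)"
        by (intro scaleR_right_mono) (auto simp: power_le_one)
      finally show ?thesis by simp
    qed
    ultimately have "inf (v i) (v k) \<le> inf (pprt (- ?a)) (pprt ?a)"
      by (intro inf_mono)
    also have "\<dots> = 0" using inf_pprt_pprt_minus[of ?a] by (simp only: inf_commute)
    finally show ?thesis by (intro antisym) (simp_all add: v_def)
  qed
  \<comment> \<open>Trimming removes \<open>inf (u k) (?z + ?w)\<close> from \<open>u k\<close>: the
    overlap with \<open>?z\<close> costs at most \<open>\<delta> / 4\<close>, that with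
    \<open>?w\<close> at most \<open>norm ?w\<close>.\<close>
  have v_norm: "3 / 4 * \<delta> - (1 / 2) ^ k * norm w \<le> norm (v k)" for k
  proof -
    let ?z = "4 ^ k *\<^sub>R s k" and ?w = "(1 / 2) ^ k *\<^sub>R w"
    have zw: "0 \<le> ?z" "0 \<le> ?w" using s_nonneg w_nonneg by (auto intro: scaleR_nonneg_nonneg)
    have "inf (u k) (?z + ?w) \<le> inf ?z (u k) + inf ?w (u k)"
      using inf_add_le[OF zw u_nonneg[of k]] by (simp add: inf_commute)
    also have "\<dots> \<le> inf ?z (u k) + ?w" by (intro add_left_mono) simp
    finally have "norm (inf (u k) (?z + ?w)) \<le> norm (inf ?z (u k) + ?w)"
      using zw u_nonneg by (intro norm_mono_nonneg) auto
    also have "\<dots> \<le> \<delta> / 4 + (1 / 2) ^ k * norm w"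
      using good[of k] norm_triangle_ineq[of "inf ?z (u k)" ?w] by (simp add: good_def)
    finally have "norm (inf (u k) (?z + ?w)) \<le> \<delta> / 4 + (1 / 2) ^ k * norm w" .
    moreover have "u k = v k + inf (u k) (?z + ?w)"
      using diff_pprt_diff[of "u k" "?z + ?w"] by (simp add: v_def algebra_simps)
    then have "norm (u k) \<le> norm (v k) + norm (inf (u k) (?z + ?w))"
      by (metis norm_triangle_ineq)
    ultimately show ?thesis using good[of k] by (simp add: good_def)
  qed
  have "(\<lambda>k. (1 / 2) ^ k * norm w) \<longlonglongrightarrow> 0 * norm w"
    by (intro tendsto_mult_right LIMSEQ_power_zero) simp
  then have "eventually (\<lambda>k. (1 / 2) ^ k * norm w < \<delta> / 4) sequentially"
    using \<delta>(1) by (intro order_tendstoD(2)) auto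
  then obtain K where K: "\<And>k. K \<le> k \<Longrightarrow> (1 / 2) ^ k * norm w < \<delta> / 4"
    by (auto simp: eventually_sequentially)
  have v_le: "\<exists>m. v k \<le> x m" for k
  proof -
    obtain a b where ab: "u k = x b - x a" using good[of k] by (auto simp: good_def)
    have "0 \<le> 4 ^ k *\<^sub>R s k + (1 / 2) ^ k *\<^sub>R w"
      using s_nonneg w_nonneg by (intro add_nonneg_nonneg scaleR_nonneg_nonneg) auto
    from diff_left_mono[OF this, of "u k"] have "v k \<le> pprt (u k)"
      unfolding v_def by (intro pprt_mono) simp
    also have "\<dots> = x b - x a" using u_nonneg[of k] ab by simp
    also have "\<dots> \<le> x b" using x(2) by simp
    finally show ?thesis by blast
  qed
  \<comment> \<open>From index \<open>K\<close> on, the part of the loss due to \<open>w\<close> is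
    below \<open>\<delta> / 4\<close>, which leaves \<open>\<delta> / 2\<close>.\<close>
  show ?thesis
  proof (intro exI[of _ "\<lambda>k. v (k + K)"] exI[of _ "\<delta> / 2"] conjI allI impI)
    show "\<delta> / 2 \<le> norm (v (k + K))" for k
      using v_norm[of "k + K"] K[of "k + K"] by simp
    show "inf (v (i + K)) (v (k + K)) = 0" if "i \<noteq> k" for i k
      using that disj[of "i + K" "k + K"] disj[of "k + K" "i + K"]
      by (cases i k rule: linorder_cases) (auto simp: inf_commute)
  qed (use \<delta>(1) v_le in \<open>auto simp: v_def\<close>)
qed

section \<open>Functionals carried by disjoint bands, and diagonal operators\<close>

text \<open>With an order continuous norm this is the norm of the projection of
  \<open>pprt x\<close> onto the band generated by \<open>v\<close>; the supremum over truncations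
  avoids constructing the projection. The positive part makes every dominated linear functional
  positive.\<close>

definition band_seminorm :: "'a::banach_lattice \<Rightarrow> 'a \<Rightarrow> real"
  where "band_seminorm v x = (SUP m\<in>{0..}. norm (inf (pprt x) (m *\<^sub>R v)))"

lemma norm_inf_pprt_le:
  fixes v :: "'a::banach_lattice"
  assumes "0 \<le> v" "0 \<le> m" shows "norm (inf (pprt x) (m *\<^sub>R v)) \<le> norm x"
proof -
  have "norm (inf (pprt x) (m *\<^sub>R v)) \<le> norm (pprt x)"
    using assms by (intro norm_mono_nonneg) (auto intro: scaleR_nonneg_nonneg)
  then show ?thesis using norm_pprt_le[of x] by linarith
qed

lemma band_seminorm_le:
  assumes "\<And>m. 0 \<le> m \<Longrightarrow> norm (inf (pprt x) (m *\<^sub>R v)) \<le> b"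
  shows "band_seminorm v x \<le> b"
  unfolding band_seminorm_def using assms by (intro cSUP_least) auto

lemma band_seminorm_ge:
  assumes "0 \<le> v" "0 \<le> m" shows "norm (inf (pprt x) (m *\<^sub>R v)) \<le> band_seminorm v x"
  unfolding band_seminorm_def
  by (rule cSUP_upper) (use assms in \<open>auto intro!: bdd_aboveI2 norm_inf_pprt_le\<close>)

lemma sublinear_band_seminorm:
  fixes v :: "'a::banach_lattice"
  assumes v: "0 \<le> v" shows "sublinear (band_seminorm v)"
  unfolding sublinear_def
proof (intro conjI allI impI)
  fix x y
  show "band_seminorm v (x + y) \<le> band_seminorm v x + band_seminorm v y"
  proof (rule band_seminorm_le)
    fix m :: real assume m: "0 \<le> m"
    then have mv: "0 \<le> m *\<^sub>R v" using v by (rule scaleR_nonneg_nonneg)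
    have "inf (pprt (x + y)) (m *\<^sub>R v) \<le> inf (pprt x + pprt y) (m *\<^sub>R v)"
      by (intro inf_mono pprt_add_le order_refl)
    also have "\<dots> \<le> inf (pprt x) (m *\<^sub>R v) + inf (pprt y) (m *\<^sub>R v)"
      by (intro inf_add_le mv) auto
    finally have "norm (inf (pprt (x + y)) (m *\<^sub>R v))
        \<le> norm (inf (pprt x) (m *\<^sub>R v) + inf (pprt y) (m *\<^sub>R v))"
      using mv by (intro norm_mono_nonneg) auto
    also have "\<dots> \<le> norm (inf (pprt x) (m *\<^sub>R v)) + norm (inf (pprt y) (m *\<^sub>R v))"
      by (rule norm_triangle_ineq)
    also have "\<dots> \<le> band_seminorm v x + band_seminorm v y"
      by (intro add_mono band_seminorm_ge v m)
    finally show "norm (inf (pprt (x + y)) (m *\<^sub>R v)) \<le> band_seminorm v x + band_seminorm v y" .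
  qed
next
  fix c :: real and x :: 'a assume c: "0 \<le> c"
  have le: "band_seminorm v (c *\<^sub>R x) \<le> c * band_seminorm v x" if c: "0 < c" for c x
  proof (rule band_seminorm_le)
    fix m :: real assume m: "0 \<le> m"
    have "inf (pprt (c *\<^sub>R x)) (m *\<^sub>R v) = c *\<^sub>R inf (pprt x) ((m / c) *\<^sub>R v)"
      using c by (simp add: scaleR_pprt scaleR_inf_distrib)
    then show "norm (inf (pprt (c *\<^sub>R x)) (m *\<^sub>R v)) \<le> c * band_seminorm v x"
      using band_seminorm_ge[OF v, of "m / c" x] c m by (simp add: mult_left_mono)
  qed
  show "band_seminorm v (c *\<^sub>R x) = c * band_seminorm v x"
  proof (cases "c = 0")
    case True
    have "inf 0 (m *\<^sub>R v) = 0" if "0 \<le> m" for m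
      using that v by (intro inf_absorb1 scaleR_nonneg_nonneg)
    with True show ?thesis by (simp add: band_seminorm_def)
  next
    case False
    with c have c: "0 < c" by simp
    have "c * band_seminorm v x \<le> band_seminorm v (c *\<^sub>R x)"
      using le[of "inverse c" "c *\<^sub>R x"] c by (simp add: field_simps)
    with le[OF c] show ?thesis by (intro antisym)
  qed
qed

text \<open>All properties come from domination by \<open>band_seminorm v\<close>: it is at most the
  norm, it vanishes at \<open>- x\<close> for \<open>x \<ge> 0\<close> and at every positive
  \<open>x\<close> disjoint from \<open>v\<close>, and it equals \<open>norm v\<close> at
  \<open>v\<close>, where Hahn-Banach makes \<open>f\<close> attain it.\<close>

lemma band_functional:
  fixes v :: "'a::banach_lattice"
  assumes v: "0 \<le> v"
  obtains f where "linear f" "\<And>x. f x \<le> band_seminorm v x" "\<And>x. \<bar>f x\<bar> \<le> norm x"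
    "\<And>x. 0 \<le> x \<Longrightarrow> 0 \<le> f x" "f v = norm v"
    "\<And>x. 0 \<le> x \<Longrightarrow> inf x v = 0 \<Longrightarrow> f x = 0"
proof -
  obtain f where lin: "linear f" and le: "\<And>x. f x \<le> band_seminorm v x"
    and eq: "f v = band_seminorm v v"
    using hahn_banach_sublinear[OF sublinear_band_seminorm[OF v]] by blast
  have norm_le: "band_seminorm v x \<le> norm x" for x
    by (intro band_seminorm_le norm_inf_pprt_le v)
  have bound: "\<bar>f x\<bar> \<le> norm x" for x
    using order_trans[OF le norm_le, of x] order_trans[OF le norm_le, of "- x"]
    by (simp add: linear_neg[OF lin])
  have pos: "0 \<le> f x" if x: "0 \<le> x" for x
  proof -
    have "f (- x) \<le> 0"
    proof (rule order_trans[OF le band_seminorm_le])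
      fix m :: real assume "0 \<le> m"
      then have "0 \<le> m *\<^sub>R v" using v by (rule scaleR_nonneg_nonneg)
      then show "norm (inf (pprt (- x)) (m *\<^sub>R v)) \<le> 0" using x by (simp add: inf_absorb1)
    qed
    then show ?thesis by (simp add: linear_neg[OF lin])
  qed
  have "f v = norm v"
    using norm_le[of v] band_seminorm_ge[OF v, of 1 v] v eq by simp
  moreover have "f x = 0" if x: "0 \<le> x" "inf x v = 0" for x
  proof (rule antisym)
    show "f x \<le> 0"
    proof (rule order_trans[OF le band_seminorm_le])
      fix m :: real assume m: "0 \<le> m"
      then have mv: "0 \<le> m *\<^sub>R v" using v by (rule scaleR_nonneg_nonneg)
      \<comment> \<open>The factor \<open>1 + m\<close> exceeds both 1 and \<open>m\<close>, so it
        can be pulled out of the infimum whether \<open>m\<close> is small or large.\<close>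
      have "inf x (m *\<^sub>R v) \<le> inf ((1 + m) *\<^sub>R x) ((1 + m) *\<^sub>R v)"
        using m x v mv by (intro inf_mono) (simp_all add: scaleR_add_left scaleR_nonneg_nonneg)
      also have "\<dots> = (1 + m) *\<^sub>R inf x v" using m by (simp add: scaleR_inf_distrib)
      finally have "inf x (m *\<^sub>R v) = 0" using x mv by (intro antisym) auto
      then show "norm (inf (pprt x) (m *\<^sub>R v)) \<le> 0" using x by simp
    qed
  qed (rule pos[OF x(1)])
  ultimately show thesis using that lin le bound pos by blast
qed

lemma inf_sum_eq_0:
  fixes y :: "nat \<Rightarrow> 'a::banach_lattice"
  assumes "\<And>i. 0 \<le> y i" "0 \<le> z" "\<And>i. i < n \<Longrightarrow> inf (y i) z = 0"
  shows "inf (\<Sum>i<n. y i) z = 0"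
  using assms(3)
proof (induction n)
  case (Suc n)
  have "inf (\<Sum>i<Suc n. y i) z \<le> inf (\<Sum>i<n. y i) z + inf (y n) z"
    using assms(1,2) by (simp add: inf_add_le sum_nonneg)
  also have "\<dots> = 0" using Suc by simp
  finally show ?case using assms(1,2) by (intro antisym le_infI sum_nonneg) auto
qed (use assms(2) in \<open>simp add: inf_absorb1\<close>)

text \<open>By \<open>a + b = inf a b + sup a b\<close>, disjoint sums are suprema, and a supremum
  stays below a common upper bound.\<close>

lemma sum_disjoint_le:
  fixes y :: "nat \<Rightarrow> 'a::banach_lattice"
  assumes y: "\<And>i. 0 \<le> y i" "\<And>i. y i \<le> x" and disj: "\<And>i k. i < k \<Longrightarrow> inf (y i) (y k) = 0"
  shows "(\<Sum>i<n. y i) \<le> x"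
proof (induction n)
  case (Suc n)
  have "(\<Sum>i<Suc n. y i) = sup (\<Sum>i<n. y i) (y n)"
    using add_eq_inf_sup[of "\<Sum>i<n. y i" "y n"] inf_sum_eq_0[OF y(1) y(1)[of n] disj] by simp
  then show ?case using Suc y(2) by simp
qed (use order_trans[OF y] in simp)

text \<open>Otherwise every \<open>v k\<close> cuts a piece \<open>y k\<close> of norm at least
  \<open>e / 2\<close> out of \<open>pprt x\<close>. The pieces are disjoint, so their partial sums
  increase below \<open>pprt x\<close> and converge, which forces the pieces to tend to 0.\<close>

lemma disjoint_band_seminorm_small:
  fixes v :: "nat \<Rightarrow> 'a::banach_lattice"
  assumes obc: "order_bounded_convergent TYPE('a)"
    and v: "\<And>k. 0 \<le> v k" "\<And>i k. i \<noteq> k \<Longrightarrow> inf (v i) (v k) = 0" and e: "0 < e"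
  shows "\<exists>k. band_seminorm (v k) x < e"
proof (rule ccontr)
  assume "\<not> ?thesis"
  then have ge: "e \<le> band_seminorm (v k) x" for k by (simp add: not_less)
  have "\<exists>m\<ge>0. e / 2 \<le> norm (inf (pprt x) (m *\<^sub>R v k))" for k
  proof (rule ccontr)
    assume "\<not> ?thesis"
    then have "band_seminorm (v k) x \<le> e / 2"
      by (intro band_seminorm_le) (metis linear)
    with ge[of k] e show False by simp
  qed
  then obtain m where m: "\<And>k. 0 \<le> m k" "\<And>k. e / 2 \<le> norm (inf (pprt x) (m k *\<^sub>R v k))" by metis
  define y where "y k = inf (pprt x) (m k *\<^sub>R v k)" for k
  have y_nonneg: "0 \<le> y k" for k
    using m(1) v(1) by (simp add: y_def scaleR_nonneg_nonneg)
  have disj: "inf (y i) (y k) = 0" if "i < k" for i k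
  proof (rule antisym)
    \<comment> \<open>A common factor for both truncations, so that disjointness of
      \<open>v i\<close> and \<open>v k\<close> passes to \<open>y i\<close> and
      \<open>y k\<close>.\<close>
    let ?c = "m i + m k"
    have "y i \<le> ?c *\<^sub>R v i"
      unfolding y_def using m(1) v(1) by (intro le_infI2 scaleR_right_mono) auto
    moreover have "y k \<le> ?c *\<^sub>R v k"
      unfolding y_def using m(1) v(1) by (intro le_infI2 scaleR_right_mono) auto
    ultimately have "inf (y i) (y k) \<le> inf (?c *\<^sub>R v i) (?c *\<^sub>R v k)" by (rule inf_mono)
    also have "\<dots> = ?c *\<^sub>R inf (v i) (v k)"
      using m(1)[of i] m(1)[of k] by (intro scaleR_inf_distrib[symmetric]) simp
    finally show "inf (y i) (y k) \<le> 0" using v(2)[of i k] that by simp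
  qed (use y_nonneg in simp)
  have le: "(\<Sum>i<n. y i) \<le> pprt x" for n
    by (intro sum_disjoint_le y_nonneg disj) (simp add: y_def)
  have "incseq (\<lambda>n. \<Sum>i<n. y i)"
    using y_nonneg by (intro incseq_SucI) simp
  with obc le have "convergent (\<lambda>n. \<Sum>i<n. y i)"
    unfolding order_bounded_convergent_def by blast
  then have "summable y" by (simp add: summable_iff_convergent)
  then have "y \<longlonglongrightarrow> 0" by (rule summable_LIMSEQ_zero)
  then obtain k where "norm (y k) < e / 2"
    using e unfolding LIMSEQ_iff by (metis diff_zero half_gt_zero order_refl)
  with m(2)[of k] show False by (simp add: y_def)
qed

section \<open>Compactness by approximation, and diagonal series\<close>

text \<open>A finite \<open>e / 4\<close>-net of \<open>K\<close> is an \<open>e / 2\<close>-net of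
  \<open>S\<close>. Closed balls of that radius form a closed finite union, so they also cover the
  closure.\<close>

lemma compact_closure_if_approximable:
  fixes S :: "'a::banach set"
  assumes "\<And>e. 0 < e \<Longrightarrow> \<exists>K. compact K \<and> (\<forall>s\<in>S. \<exists>x\<in>K. dist x s \<le> e)"
  shows "compact (closure S)"
  unfolding compact_eq_totally_bounded
proof (intro conjI allI impI)
  show "complete (closure S)" by (simp add: complete_eq_closed)
  fix e :: real assume e: "0 < e"
  then obtain K where K: "compact K" "\<And>s. s \<in> S \<Longrightarrow> \<exists>x\<in>K. dist x s \<le> e / 4"
    using assms[of "e / 4"] by auto
  obtain k where k: "finite k" "K \<subseteq> (\<Union>x\<in>k. ball x (e / 4))"
    using K(1) e unfolding compact_eq_totally_bounded by (meson zero_less_divide_iff zero_less_numeral)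
  have "S \<subseteq> (\<Union>x\<in>k. cball x (e / 2))"
  proof
    fix s assume "s \<in> S"
    then obtain x where x: "x \<in> K" "dist x s \<le> e / 4" using K(2) by blast
    then obtain c where "c \<in> k" "dist c x < e / 4" using k(2) by auto
    with x dist_triangle[of c s x] show "s \<in> (\<Union>x\<in>k. cball x (e / 2))"
      by (intro UN_I[of c]) auto
  qed
  then have "closure S \<subseteq> (\<Union>x\<in>k. cball x (e / 2))"
    by (intro closure_minimal closed_UN k(1)) auto
  also have "\<dots> \<subseteq> (\<Union>x\<in>k. ball x e)" using e by fastforce
  finally show "\<exists>k. finite k \<and> closure S \<subseteq> (\<Union>x\<in>k. ball x e)" using k(1) by blast
qed

text \<open>The combinations form a sum of segments; each induction step adds one compact segment to
  a compact set.\<close>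

lemma compact_bounded_combinations:
  fixes w :: "nat \<Rightarrow> 'a::real_normed_vector"
  shows "\<exists>K. compact K \<and> (\<forall>t::nat \<Rightarrow> real. (\<forall>k<n. \<bar>t k\<bar> \<le> 1) \<longrightarrow> (\<Sum>k<n. t k *\<^sub>R w k) \<in> K)"
proof (induction n)
  case 0
  show ?case by (intro exI[of _ "{0}"]) simp
next
  case (Suc n)
  then obtain K where K: "compact K"
    "\<And>t::nat \<Rightarrow> real. (\<forall>k<n. \<bar>t k\<bar> \<le> 1) \<Longrightarrow> (\<Sum>k<n. t k *\<^sub>R w k) \<in> K" by blast
  let ?L = "(\<lambda>t::real. t *\<^sub>R w n) ` {-1..1}"
  have "compact ?L" by (intro compact_continuous_image continuous_intros) auto
  then have "compact {a + b | a b. a \<in> K \<and> b \<in> ?L}" using K(1) by (intro compact_sums)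
  moreover have "(\<Sum>k<Suc n. t k *\<^sub>R w k) \<in> {a + b | a b. a \<in> K \<and> b \<in> ?L}"
    if "\<forall>k<Suc n. \<bar>t k\<bar> \<le> 1" for t :: "nat \<Rightarrow> real"
  proof -
    have "t n *\<^sub>R w n \<in> ?L" using that by (intro imageI) (auto simp: abs_le_iff)
    moreover have "(\<Sum>k<n. t k *\<^sub>R w k) \<in> K" using that by (intro K(2)) simp
    ultimately show ?thesis unfolding sum.lessThan_Suc by blast
  qed
  ultimately show ?case by blast
qed

definition diagonal_operator :: "(nat \<Rightarrow> 'a \<Rightarrow> real) \<Rightarrow> (nat \<Rightarrow> 'b) \<Rightarrow> 'a \<Rightarrow> 'b::banach"
  where "diagonal_operator f e x = suminf (\<lambda>k. ((1 / 2) ^ k * f k x) *\<^sub>R e k)"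

context
  fixes f :: "nat \<Rightarrow> 'a::real_normed_vector \<Rightarrow> real" and e :: "nat \<Rightarrow> 'b::banach"
  assumes lin: "\<And>k. linear (f k)" and f_le: "\<And>k x. \<bar>f k x\<bar> \<le> norm x" and e_le: "\<And>k. norm (e k) \<le> 1"
begin

lemma diagonal_term_le: "norm (((1 / 2) ^ k * f k x) *\<^sub>R e k) \<le> (1 / 2) ^ k * norm x"
  using mult_mono[OF f_le e_le, of x k k] by (simp add: abs_mult mult.assoc mult_left_mono)

lemma summable_diagonal_norm: "summable (\<lambda>k. norm (((1 / 2) ^ k * f k x) *\<^sub>R e k))"
proof (rule summable_comparison_test')
  show "summable (\<lambda>k. (1 / 2) ^ k * norm x)" by (intro summable_mult2 summable_geometric) simp
qed (use diagonal_term_le in simp)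

lemma diagonal_sums: "(\<lambda>k. ((1 / 2) ^ k * f k x) *\<^sub>R e k) sums diagonal_operator f e x"
  unfolding diagonal_operator_def
  by (rule summable_sums[OF summable_norm_cancel[OF summable_diagonal_norm]])

text \<open>A geometric tail estimate. The case \<open>n = 0\<close> bounds the operator; general
  \<open>n\<close> approximates it by finite rank operators uniformly on the ball.\<close>

lemma norm_diagonal_tail_le:
  "norm (diagonal_operator f e x - (\<Sum>k<n. ((1 / 2) ^ k * f k x) *\<^sub>R e k)) \<le> 2 * (1 / 2) ^ n * norm x"
proof -
  let ?t = "\<lambda>k. ((1 / 2) ^ k * f k x) *\<^sub>R e k"
  have "(\<lambda>k. (1 / 2) ^ (k + n) * norm x) = (\<lambda>k. ((1 / 2) ^ n * norm x) * (1 / 2) ^ k)"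
    by (simp add: power_add mult_ac)
  then have geo: "(\<lambda>k. (1 / 2) ^ (k + n) * norm x) sums ((1 / 2) ^ n * norm x * 2)"
    using sums_mult[OF geometric_sums[of "1 / 2 :: real"], of "(1 / 2) ^ n * norm x"] by simp
  have "diagonal_operator f e x - (\<Sum>k<n. ?t k) = suminf (\<lambda>k. ?t (k + n))"
    unfolding diagonal_operator_def
    using suminf_split_initial_segment[OF summable_norm_cancel[OF summable_diagonal_norm], of x n] by simp
  also have "norm \<dots> \<le> suminf (\<lambda>k. norm (?t (k + n)))"
    using summable_diagonal_norm by (intro summable_norm) (subst summable_iff_shift)
  also have "\<dots> \<le> suminf (\<lambda>k. (1 / 2) ^ (k + n) * norm x)"
    by (intro suminf_le diagonal_term_le sums_summable[OF geo])
      (use summable_diagonal_norm in \<open>subst summable_iff_shift\<close>)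
  also have "\<dots> = 2 * (1 / 2) ^ n * norm x" using sums_unique[OF geo] by simp
  finally show ?thesis .
qed

lemma bounded_linear_diagonal: "bounded_linear (diagonal_operator f e)"
proof (rule bounded_linear_intro[where K = 2])
  fix x y :: 'a and r :: real
  have "(\<lambda>k. ((1 / 2) ^ k * f k x) *\<^sub>R e k + ((1 / 2) ^ k * f k y) *\<^sub>R e k)
      sums (diagonal_operator f e x + diagonal_operator f e y)"
    by (intro sums_add diagonal_sums)
  then have "(\<lambda>k. ((1 / 2) ^ k * f k (x + y)) *\<^sub>R e k)
      sums (diagonal_operator f e x + diagonal_operator f e y)"
    by (simp add: linear_add[OF lin] distrib_left scaleR_add_left)
  then show "diagonal_operator f e (x + y) = diagonal_operator f e x + diagonal_operator f e y"
    using diagonal_sums sums_unique2 by blast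
  have "(\<lambda>k. r *\<^sub>R (((1 / 2) ^ k * f k x) *\<^sub>R e k)) sums (r *\<^sub>R diagonal_operator f e x)"
    by (intro sums_scaleR_right diagonal_sums)
  then have "(\<lambda>k. ((1 / 2) ^ k * f k (r *\<^sub>R x)) *\<^sub>R e k) sums (r *\<^sub>R diagonal_operator f e x)"
    by (simp add: linear_scale[OF lin] mult_ac)
  then show "diagonal_operator f e (r *\<^sub>R x) = r *\<^sub>R diagonal_operator f e x"
    using diagonal_sums sums_unique2 by blast
  show "norm (diagonal_operator f e x) \<le> norm x * 2"
    using norm_diagonal_tail_le[of x 0] by simp
qed

text \<open>The truncation at \<open>n\<close> maps the ball into a compact set: with the weights
  moved into the vectors, its coefficients \<open>f k x\<close> lie in
  \<open>[-1, 1]\<close>.\<close>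

lemma compact_diagonal: "compact (closure (diagonal_operator f e ` cball 0 1))"
proof (rule compact_closure_if_approximable)
  fix d :: real assume "0 < d"
  then obtain n where n: "(1 / 2) ^ n < d / 2"
    using real_arch_pow_inv[of "d / 2" "1 / 2"] by auto
  obtain K where K: "compact K" "\<And>t::nat \<Rightarrow> real. (\<forall>k<n. \<bar>t k\<bar> \<le> 1) \<Longrightarrow>
      (\<Sum>k<n. t k *\<^sub>R ((1 / 2) ^ k *\<^sub>R e k)) \<in> K"
    using compact_bounded_combinations[of n "\<lambda>k. (1 / 2) ^ k *\<^sub>R e k"] by blast
  have "\<exists>y\<in>K. dist y (diagonal_operator f e x) \<le> d" if x: "norm x \<le> 1" for x
  proof (rule bexI)
    show "(\<Sum>k<n. f k x *\<^sub>R ((1 / 2) ^ k *\<^sub>R e k)) \<in> K"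
      using order_trans[OF f_le x] by (intro K(2)) simp
    have "2 * (1 / 2) ^ n * norm x \<le> 2 * (1 / 2) ^ n"
      using x by (intro mult_left_le) auto
    also have "\<dots> \<le> d" using n by simp
    finally have "2 * (1 / 2) ^ n * norm x \<le> d" .
    then show "dist (\<Sum>k<n. f k x *\<^sub>R ((1 / 2) ^ k *\<^sub>R e k)) (diagonal_operator f e x) \<le> d"
      using norm_diagonal_tail_le[of x n] by (simp add: dist_norm norm_minus_commute mult.commute)
  qed
  with K(1) show "\<exists>K. compact K \<and> (\<forall>s\<in>diagonal_operator f e ` cball 0 1. \<exists>x\<in>K. dist x s \<le> d)"
    by (intro exI[of _ K]) auto
qed

end

section \<open>A compact positive operator that is not KB\<close>

lemma nrm_minus_self: "nrm self (a \<ominus>\<^bsub>self\<^esub> b) = norm (a - b :: 'a::banach_lattice)"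
  by (simp add: a_minus_def minus_self, simp add: self_def)

lemma tails_neq_bot: "directed_set A r \<Longrightarrow> tails A r \<noteq> bot"
  using eventually_tails[of A r "\<lambda>_. False"]
  by (auto simp: directed_set_def preorder_on_def refl_on_def eventually_False simp flip: trivial_limit_def)

text \<open>The sequence becomes a net indexed by a copy of its own range in \<open>'a + 'u\<close>,
  ordered as in the lattice, and rescaled by \<open>B\<close> into the unit ball.\<close>

lemma KB_ops_sequence:
  fixes x :: "nat \<Rightarrow> 'a::banach_lattice" and T :: "'a \<Rightarrow> 'b::banach_lattice"
  assumes T: "T \<in> KB_ops TYPE('a + 'u) self" and x: "incseq x" "\<And>n. 0 \<le> x n" "\<And>n. norm (x n) \<le> M"
  shows "\<exists>x0. (\<lambda>n. T (x n)) \<longlonglongrightarrow> T x0"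
proof -
  define B where "B = max M 1"
  have B: "0 < B" and x_le: "norm (x n) \<le> B" for n
    using x(3)[of n] by (auto simp: B_def)
  have lin: "bounded_linear T" using T by (auto simp: KB_ops_def bounded_ops_self)
  let ?A = "range (\<lambda>n. Inl (x n) :: 'a + 'u)"
  let ?r = "{(Inl p, Inl q) | p q. p \<in> range x \<and> q \<in> range x \<and> p \<le> q} :: (('a + 'u) \<times> ('a + 'u)) set"
  let ?y = "\<lambda>a :: 'a + 'u. (1 / B) *\<^sub>R projl a"
  have dir: "directed_set ?A ?r"
    unfolding directed_set_def preorder_on_def
  proof (intro conjI ballI)
    fix a b assume "a \<in> ?A" "b \<in> ?A"
    then obtain m n where "a = Inl (x m)" "b = Inl (x n)" by blast
    then show "\<exists>c\<in>?A. (a, c) \<in> ?r \<and> (b, c) \<in> ?r"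
      using x(1) by (intro bexI[of _ "Inl (x (max m n))"]) (auto simp: incseq_def)
  qed (auto simp: refl_on_def trans_def)
  have "increasing_ball_net ?A ?r ?y"
    unfolding increasing_ball_net_def using dir x(2) x_le B
    by (auto simp: monotone_on_def scaleR_left_mono scaleR_nonneg_nonneg)
  then obtain x0 where "((\<lambda>a. nrm self (T (?y a) \<ominus>\<^bsub>self\<^esub> T x0)) \<longlongrightarrow> 0) (tails ?A ?r)"
    using T unfolding KB_ops_def by blast
  then have lim: "((\<lambda>a. norm (T (?y a) - T x0)) \<longlongrightarrow> 0) (tails ?A ?r)"
    by (simp only: nrm_minus_self)
  \<comment> \<open>The tail of the net above \<open>Inl (x N)\<close> contains
    \<open>Inl (x n)\<close> for all \<open>n \<ge> N\<close>, so net convergence gives sequential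
    convergence.\<close>
  have "(\<lambda>n. T ((1 / B) *\<^sub>R x n)) \<longlonglongrightarrow> T x0"
    unfolding LIMSEQ_iff
  proof (intro allI impI)
    fix e :: real assume "0 < e"
    with lim have "eventually (\<lambda>a. norm (T (?y a) - T x0) < e) (tails ?A ?r)"
      by (auto dest: order_tendstoD(2))
    then obtain N where N: "\<And>b. b \<in> ?A \<Longrightarrow> (Inl (x N), b) \<in> ?r \<Longrightarrow> norm (T (?y b) - T x0) < e"
      unfolding eventually_tails[OF dir] by blast
    have "norm (T ((1 / B) *\<^sub>R x n) - T x0) < e" if "N \<le> n" for n
      using N[of "Inl (x n)"] incseqD[OF x(1) that] by auto
    then show "\<exists>no. \<forall>n\<ge>no. norm (T ((1 / B) *\<^sub>R x n) - T x0) < e" by blast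
  qed
  from tendsto_scaleR[OF tendsto_const[of B] this] B
  have "(\<lambda>n. T (x n)) \<longlonglongrightarrow> T (B *\<^sub>R x0)"
    by (simp add: linear_scale[OF bounded_linear.linear[OF lin]])
  then show ?thesis by blast
qed

lemma compact_ops_self_iff:
  "(T :: 'a::banach_lattice \<Rightarrow> 'b::banach_lattice) \<in> compact_ops self \<longleftrightarrow>
    bounded_linear T \<and> compact (closure (T ` cball 0 1))"
  unfolding compact_ops_def bounded_ops_self ndist_self by (simp add: self_def)

theorem compact_positive_not_KB:
  assumes obc: "order_bounded_convergent TYPE('a::banach_lattice)" and "\<not> KB_space TYPE('a::banach_lattice)"
  obtains T :: "'a::banach_lattice \<Rightarrow> 'a" where "T \<in> compact_ops self" "T \<in> positive_maps self"
    "T \<notin> KB_ops TYPE('a + 'u) self"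
proof -
  obtain x :: "nat \<Rightarrow> 'a" where x: "incseq x" "\<And>n. 0 \<le> x n" "bounded (range x)" "\<not> convergent x"
    using assms(2) unfolding KB_space_def by blast
  obtain M where M: "\<And>n. norm (x n) \<le> M" using x(3) by (auto simp: bounded_iff)
  obtain v :: "nat \<Rightarrow> 'a" and \<delta> where *: "0 < \<delta> \<and>
      (\<forall>k. 0 \<le> v k \<and> \<delta> \<le> norm (v k) \<and> (\<exists>m. v k \<le> x m)) \<and>
      (\<forall>i k. i \<noteq> k \<longrightarrow> inf (v i) (v k) = 0)"
    using disjoint_minorants[OF obc x(1,2) M x(4)] by (elim exE)
  then have \<delta>: "0 < \<delta>" and v: "\<And>k. 0 \<le> v k" "\<And>k. \<delta> \<le> norm (v k)"
    "\<And>i k. i \<noteq> k \<Longrightarrow> inf (v i) (v k) = 0" "\<And>k. \<exists>m. v k \<le> x m"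
    by simp_all
  have "\<exists>f. linear f \<and> (\<forall>x. f x \<le> band_seminorm (v k) x) \<and> (\<forall>x. \<bar>f x\<bar> \<le> norm x) \<and>
      (\<forall>x\<ge>0. 0 \<le> f x) \<and> f (v k) = norm (v k) \<and> (\<forall>x\<ge>0. inf x (v k) = 0 \<longrightarrow> f x = 0)" for k
    using band_functional[OF v(1)[of k]] by metis
  then obtain f where f: "\<And>k. linear (f k)" "\<And>k x. f k x \<le> band_seminorm (v k) x"
    "\<And>k x. \<bar>f k x\<bar> \<le> norm x" "\<And>k x. 0 \<le> x \<Longrightarrow> 0 \<le> f k x" "\<And>k. f k (v k) = norm (v k)"
    "\<And>k x. 0 \<le> x \<Longrightarrow> inf x (v k) = 0 \<Longrightarrow> f k x = 0"
    by metis
  define e where "e k = (1 / norm (v k)) *\<^sub>R v k" for k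
  have v_pos: "0 < norm (v k)" for k by (rule less_le_trans[OF \<delta> v(2)])
  have e_norm: "norm (e k) \<le> 1" for k by (simp add: e_def)
  \<comment> \<open>Biorthogonality holds because \<open>f j\<close> vanishes on the elements
    disjoint from \<open>v j\<close>. Hence \<open>f j\<close> recovers \<open>f j y\<close> from
    the image of \<open>y\<close>, up to the weight.\<close>
  have f_e: "f j (e k) = (if k = j then 1 else 0)" for j k
    using f(5)[of j] f(6)[of "v k" j] v(1,3) v_pos[of j]
    by (auto simp: e_def linear_scale[OF f(1)])
  have bl_f: "bounded_linear (f k)" for k
    using f(1,3) by (intro bounded_linear_intro[where K = 1]) (auto simp: linear_add linear_scale)
  let ?T = "diagonal_operator f e"
  note diag = f(1) f(3) e_norm
  have bl: "bounded_linear ?T" by (rule bounded_linear_diagonal[OF diag])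
  have f_T: "f j (?T y) = (1 / 2) ^ j * f j y" for j y
  proof -
    have "(\<lambda>k. f j (((1 / 2) ^ k * f k y) *\<^sub>R e k)) sums f j (?T y)"
      by (rule bounded_linear.sums[OF bl_f diagonal_sums[OF diag]])
    moreover have "f j (((1 / 2) ^ k * f k y) *\<^sub>R e k) = (if k = j then (1 / 2) ^ k * f k y else 0)" for k
      by (simp add: linear_scale[OF f(1)] f_e)
    ultimately show ?thesis
      using sums_single[of j "\<lambda>k. (1 / 2) ^ k * f k y"] sums_unique2 by (auto simp: eq_commute[of j])
  qed
  have "?T \<in> compact_ops self"
    using compact_diagonal[OF diag] bl by (simp add: compact_ops_self_iff)
  moreover have "?T \<in> positive_maps self"
  proof -
    have "0 \<le> ?T y" if y: "0 \<le> y" for y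
    proof (rule LIMSEQ_ge_lower_bound)
      show "(\<lambda>n. \<Sum>k<n. ((1 / 2) ^ k * f k y) *\<^sub>R e k) \<longlonglongrightarrow> ?T y"
        using diagonal_sums[OF diag] by (simp add: sums_def)
      show "0 \<le> (\<Sum>k<n. ((1 / 2) ^ k * f k y) *\<^sub>R e k)" for n
        using f(4)[OF y] v(1) by (intro sum_nonneg scaleR_nonneg_nonneg) (auto simp: e_def scaleR_nonneg_nonneg)
    qed
    then show ?thesis by (simp add: positive_maps_def self_def)
  qed
  moreover have "?T \<notin> KB_ops TYPE('a + 'u) self"
  proof
    assume "?T \<in> KB_ops TYPE('a + 'u) self"
    then obtain x0 where x0: "(\<lambda>n. ?T (x n)) \<longlonglongrightarrow> ?T x0"
      using KB_ops_sequence[OF _ x(1,2) M] by blast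
    \<comment> \<open>This \<open>j\<close> yields \<open>f j x0 < \<delta>\<close>. On the other
      hand \<open>x n\<close> eventually lies above \<open>v j\<close>, where the positive
      \<open>f j\<close> takes a value of at least \<open>\<delta>\<close>.\<close>
    obtain j where j: "band_seminorm (v j) x0 < \<delta>"
      using disjoint_band_seminorm_small[of v \<delta>, OF obc v(1,3) \<delta>] by blast
    have "(\<lambda>n. (1 / 2) ^ j * f j (x n)) \<longlonglongrightarrow> (1 / 2) ^ j * f j x0"
      using bounded_linear.tendsto[OF bl_f x0, of j] by (simp add: f_T)
    then have lim: "(\<lambda>n. f j (x n)) \<longlonglongrightarrow> f j x0"
      using tendsto_mult_left_iff[of "(1 / 2) ^ j :: real"] by simp
    obtain m where m: "v j \<le> x m" using v(4) by blast
    have "\<delta> \<le> f j (x n)" if "m \<le> n" for n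
    proof -
      have "v j \<le> x n" using m incseqD[OF x(1) that] by (rule order_trans)
      then have "f j (v j) \<le> f j (x n)"
        using f(4)[of "x n - v j" j] by (simp add: linear_diff[OF f(1)])
      with f(5) v(2)[of j] show ?thesis by simp
    qed
    then have "\<delta> \<le> f j x0" by (intro LIMSEQ_le_const[OF lim]) blast
    with f(2)[of j x0] j show False by simp
  qed
  ultimately show thesis by (rule that)
qed

section \<open>Operators on KB-spaces and quasi-KB operators\<close>

text \<open>If the net were not Cauchy, an increasing sequence of its terms with gaps at least
  \<open>e\<close> could be chosen, against the KB property. An increasing chain of indices beyond
  which the oscillation tends to 0 then has a limit that the whole net shares.\<close>

lemma increasing_net_norm_convergent:
  fixes x :: "'i \<Rightarrow> 'a::banach_lattice"
  assumes KB: "KB_space TYPE('a)" and net: "increasing_ball_net A r x"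
  shows "\<exists>x0. ((\<lambda>a. norm (x a - x0)) \<longlongrightarrow> 0) (tails A r)"
proof -
  have dir: "directed_set A r" and mono: "\<And>a b. a \<in> A \<Longrightarrow> b \<in> A \<Longrightarrow> (a, b) \<in> r \<Longrightarrow> x a \<le> x b"
    and x: "\<And>a. a \<in> A \<Longrightarrow> 0 \<le> x a" "\<And>a. a \<in> A \<Longrightarrow> norm (x a) \<le> 1"
    using net by (auto simp: increasing_ball_net_def monotone_on_def)
  have ne: "A \<noteq> {}" and trans: "\<And>a b c. (a, b) \<in> r \<Longrightarrow> (b, c) \<in> r \<Longrightarrow> (a, c) \<in> r"
    and refl: "\<And>a. a \<in> A \<Longrightarrow> (a, a) \<in> r"
    and up: "\<And>a b. a \<in> A \<Longrightarrow> b \<in> A \<Longrightarrow> \<exists>c\<in>A. (a, c) \<in> r \<and> (b, c) \<in> r"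
    using dir by (auto simp: directed_set_def preorder_on_def refl_on_def dest: transD)
  have chain_convergent: "convergent (\<lambda>n. x (c n))"
    if "\<And>n. c n \<in> A" "\<And>n. (c n, c (Suc n)) \<in> r" for c :: "nat \<Rightarrow> 'i"
  proof -
    have "incseq (\<lambda>n. x (c n))" using that mono by (intro incseq_SucI) blast
    moreover have "bounded (range (\<lambda>n. x (c n)))" using that x(2) by (auto simp: bounded_iff)
    ultimately show ?thesis using KB that(1) x(1) unfolding KB_space_def by simp
  qed
  have small: "\<exists>a\<in>A. \<forall>b\<in>A. (a, b) \<in> r \<longrightarrow> norm (x b - x a) < e" if e: "0 < e" for e
  proof (rule ccontr)
    assume "\<not> ?thesis"
    then have step: "\<exists>b\<in>A. (a, b) \<in> r \<and> e \<le> norm (x b - x a)" if "a \<in> A" for a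
      using that by (meson not_less)
    obtain c where c: "\<And>n. c n \<in> A" "\<And>n. (c n, c (Suc n)) \<in> r \<and> e \<le> norm (x (c (Suc n)) - x (c n))"
      using dependent_nat_choice[of "\<lambda>_ a. a \<in> A" "\<lambda>_ a b. (a, b) \<in> r \<and> e \<le> norm (x b - x a)"]
        ne step by blast
    have "convergent (\<lambda>n. x (c n))" using c by (intro chain_convergent) auto
    then have "Cauchy (\<lambda>n. x (c n))" by (simp add: Cauchy_convergent_iff)
    then obtain N where "norm (x (c (Suc N)) - x (c N)) < e"
      using e unfolding Cauchy_def dist_norm by (meson le_Suc_eq order_refl)
    with c(2)[of N] show False by simp
  qed
  define good where "good n a \<longleftrightarrow> a \<in> A \<and> (\<forall>b\<in>A. (a, b) \<in> r \<longrightarrow> norm (x b - x a) < 2 / Suc n)" for n a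
  have good_above: "\<exists>b. good n b \<and> (a, b) \<in> r" if a: "a \<in> A" for a n
  proof -
    obtain d where d: "d \<in> A" "\<And>b. b \<in> A \<Longrightarrow> (d, b) \<in> r \<Longrightarrow> norm (x b - x d) < 1 / Suc n"
      using small[of "1 / Suc n"] by auto
    obtain c where c: "c \<in> A" "(a, c) \<in> r" "(d, c) \<in> r" using up a d(1) by blast
    have "norm (x b - x c) < 2 / Suc n" if b: "b \<in> A" "(c, b) \<in> r" for b
    proof -
      \<comment> \<open>Increments to \<open>x b\<close> shrink as the lower index grows, so the
        bound beyond \<open>d\<close> is inherited beyond \<open>c\<close>.\<close>
      have "norm (x b - x c) \<le> norm (x b - x d)"
        using mono[OF c(1) b] mono[OF d(1) c(1,3)] by (intro norm_mono_nonneg) (auto intro: diff_left_mono)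
      also have "\<dots> < 1 / Suc n" using d(2) b trans[OF c(3)] by blast
      also have "\<dots> \<le> 2 / Suc n" by (simp add: divide_right_mono)
      finally show ?thesis .
    qed
    then show ?thesis using c unfolding good_def by blast
  qed
  have "\<exists>c. \<forall>n. good n (c n) \<and> (c n, c (Suc n)) \<in> r"
  proof (rule dependent_nat_choice)
    show "\<exists>a. good 0 a" using ne good_above by blast
    show "\<exists>b. good (Suc n) b \<and> (a, b) \<in> r" if "good n a" for a n
      using good_above[of a "Suc n"] that unfolding good_def[of n] by blast
  qed
  then obtain c where c: "\<And>n. good n (c n)" "\<And>n. (c n, c (Suc n)) \<in> r" by blast
  have cA: "c n \<in> A" for n using c(1) by (auto simp: good_def)
  obtain x0 where x0: "(\<lambda>n. x (c n)) \<longlonglongrightarrow> x0"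
    using chain_convergent[of c, OF cA c(2)] by (auto simp: convergent_def)
  have "((\<lambda>a. norm (x a - x0)) \<longlongrightarrow> 0) (tails A r)"
    unfolding tendsto_iff
  proof (intro allI impI)
    fix e :: real assume e: "0 < e"
    obtain N where N: "\<And>n. N \<le> n \<Longrightarrow> norm (x (c n) - x0) < e / 2"
      using x0 e unfolding LIMSEQ_iff by (meson half_gt_zero)
    obtain N' where N': "2 / Suc N' < e / 2"
      using reals_Archimedean[of "e / 4"] e by (auto simp: field_simps)
    define n where "n = max N N'"
    have "2 / Suc n \<le> 2 / Suc N'" by (intro divide_left_mono) (auto simp: n_def)
    with N' have n: "2 / Suc n < e / 2" by simp
    have "norm (x b - x0) < e" if "b \<in> A" "(c n, b) \<in> r" for b
    proof -
      have "norm (x b - x (c n)) < e / 2" using c(1)[of n] that n unfolding good_def by force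
      moreover have "norm (x (c n) - x0) < e / 2" using N by (simp add: n_def)
      ultimately show ?thesis
        using norm_triangle_ineq[of "x b - x (c n)" "x (c n) - x0"] by simp
    qed
    then show "eventually (\<lambda>a. dist (norm (x a - x0)) 0 < e) (tails A r)"
      unfolding eventually_tails[OF dir] using cA by (intro bexI[of _ "c n"]) auto
  qed
  then show ?thesis by blast
qed

lemma (in banach_space) nrm_nonneg: "x \<in> carrier Y \<Longrightarrow> 0 \<le> nrm Y x"
  using Metric_space.nonneg[OF Metric_space_ndist, of x \<zero>]
    M.minus_equality[of \<zero> \<zero>]
  by (simp add: ndist_def a_minus_def)

lemma (in banach_space) bounded_ops_minus:
  assumes "T \<in> bounded_ops Y" shows "T x \<ominus> T y = T (x - y)"
proof -
  have car: "\<And>x. T x \<in> carrier Y" and add: "\<And>x y. T (x + y) = T x \<oplus> T y"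
    using assms by (auto simp: bounded_ops_def)
  have "T x = T (x - y) \<oplus> T y" using add[of "x - y" y] by simp
  then show ?thesis using car by (simp add: a_minus_def M.a_assoc M.r_neg)
qed

theorem KB_space_imp_bounded_ops_eq_KB_ops:
  fixes Y :: "('y, 'm) normed_structure_scheme" (structure)
  assumes KB: "KB_space TYPE('a::banach_lattice)" and "banach_space Y"
  shows "(bounded_ops Y :: ('a \<Rightarrow> 'y) set) = KB_ops TYPE('i) Y"
proof
  interpret banach_space Y by fact
  show "bounded_ops Y \<subseteq> (KB_ops TYPE('i) Y :: ('a \<Rightarrow> 'y) set)"
  proof
    fix T :: "'a \<Rightarrow> 'y" assume T: "T \<in> bounded_ops Y"
    then obtain K where K: "\<And>x. nrm Y (T x) \<le> K * norm x" and car: "\<And>x. T x \<in> carrier Y"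
      by (auto simp: bounded_ops_def)
    have "\<exists>x0. ((\<lambda>a. nrm Y (T (x a) \<ominus> T x0)) \<longlongrightarrow> 0) (tails A r)"
      if net: "increasing_ball_net A r x" for A :: "'i set" and r and x :: "'i \<Rightarrow> 'a"
    proof -
      obtain x0 where "((\<lambda>a. norm (x a - x0)) \<longlongrightarrow> 0) (tails A r)"
        using increasing_net_norm_convergent[OF KB net] by blast
      then have lim: "((\<lambda>a. K * norm (x a - x0)) \<longlongrightarrow> 0) (tails A r)"
        by (rule tendsto_mult_right_zero)
      have "((\<lambda>a. nrm Y (T (x a) \<ominus> T x0)) \<longlongrightarrow> 0) (tails A r)"
        using tendsto_const[of 0] lim
        by (rule tendsto_sandwich[rotated 2])
          (auto simp: bounded_ops_minus[OF T] intro!: always_eventually nrm_nonneg car K)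
      then show ?thesis by blast
    qed
    with T show "T \<in> KB_ops TYPE('i) Y" unfolding KB_ops_def by simp
  qed
qed (auto simp: KB_ops_def)

lemma KB_ops_subset_qKB_ops: "KB_ops TYPE('i) Y \<subseteq> qKB_ops TYPE('i) Y"
  unfolding KB_ops_def qKB_ops_def bounded_ops_def by auto (meson UNIV_I image_subset_iff)

lemma qKB_ops_subset_bounded_ops: "qKB_ops TYPE('i) Y \<subseteq> bounded_ops Y"
  by (auto simp: qKB_ops_def)

theorem KB_space_imp_qKB_ops_eq_KB_ops:
  assumes "KB_space TYPE('a::banach_lattice)" "banach_space Y"
  shows "(qKB_ops TYPE('i) Y :: ('a \<Rightarrow> 'y) set) = KB_ops TYPE('i) Y"
  using KB_ops_subset_qKB_ops qKB_ops_subset_bounded_ops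
    KB_space_imp_bounded_ops_eq_KB_ops[OF assms, where 'i = 'i] by blast

text \<open>Compactness supplies a cluster point \<open>y\<close> of the image net, which increases
  by positivity. Hence \<open>y\<close> is an upper bound, the distance to \<open>y\<close>
  decreases along the net, and one close visit suffices for each \<open>e\<close>.\<close>

lemma compact_positive_net_convergent:
  fixes T :: "'a::banach_lattice \<Rightarrow> 'b::banach_lattice"
  assumes T: "T \<in> compact_ops self" and pos: "T \<in> positive_maps self"
    and net: "increasing_ball_net A r x"
  shows "\<exists>y. ((\<lambda>a. norm (T (x a) - y)) \<longlongrightarrow> 0) (tails A r)"
proof -
  have dir: "directed_set A r" and x: "\<And>a. a \<in> A \<Longrightarrow> norm (x a) \<le> 1"
    and mono: "\<And>a b. a \<in> A \<Longrightarrow> b \<in> A \<Longrightarrow> (a, b) \<in> r \<Longrightarrow> x a \<le> x b"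
    using net by (auto simp: increasing_ball_net_def monotone_on_def)
  have trans: "\<And>a b c. (a, b) \<in> r \<Longrightarrow> (b, c) \<in> r \<Longrightarrow> (a, c) \<in> r"
    using dir by (auto simp: directed_set_def preorder_on_def dest: transD)
  have ne: "A \<noteq> {}" using dir by (auto simp: directed_set_def)
  have lin: "linear T" and cpt: "compact (closure (T ` cball 0 1))"
    using T by (auto simp: compact_ops_self_iff bounded_linear.linear)
  have T_mono: "T u \<le> T w" if "u \<le> w" for u w
  proof -
    have "0 \<le> T (w - u)" using pos that by (simp add: positive_maps_def self_def)
    then show ?thesis by (simp add: linear_diff[OF lin])
  qed
  let ?F = "filtermap (\<lambda>a. T (x a)) (tails A r)"
  have "?F \<noteq> bot" using tails_neq_bot[OF dir] by (simp add: filtermap_bot_iff)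
  moreover have "eventually (\<lambda>y. y \<in> closure (T ` cball 0 1)) ?F"
  proof -
    have "T (x a) \<in> closure (T ` cball 0 1)" if "a \<in> A" for a
      using x[OF that] closure_subset by (auto intro!: subsetD[OF closure_subset])
    then show ?thesis using ne by (auto simp: eventually_filtermap eventually_tails[OF dir])
  qed
  ultimately obtain y where y: "inf (nhds y) ?F \<noteq> bot"
    using cpt unfolding compact_filter by blast
  \<comment> \<open>The filter condition on \<open>y\<close> in terms of indices: beyond every index
    the image net comes arbitrarily close to \<open>y\<close>.\<close>
  have cluster: "\<exists>b\<in>A. (a, b) \<in> r \<and> norm (T (x b) - y) < e" if a: "a \<in> A" and e: "0 < e" for a e
  proof (rule ccontr)
    assume "\<not> ?thesis"
    then have "eventually (\<lambda>z. \<not> norm (z - y) < e) ?F"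
      using a by (auto simp: eventually_filtermap eventually_tails[OF dir])
    moreover have "eventually (\<lambda>z. norm (z - y) < e) (nhds y)"
      using e by (auto simp: eventually_nhds_metric dist_norm)
    ultimately have "eventually (\<lambda>_. False) (inf (nhds y) ?F)"
      unfolding eventually_inf by blast
    with y show False by (simp add: trivial_limit_def)
  qed
  have upper: "T (x a) \<le> y" if "a \<in> A" for a
  proof (rule le_if_approximable)
    fix e :: real assume "0 < e"
    from cluster[OF that this] obtain b where "b \<in> A" "(a, b) \<in> r" "norm (T (x b) - y) < e" by blast
    then show "\<exists>z. T (x a) \<le> z \<and> norm (z - y) \<le> e"
      using T_mono mono that by (intro exI[of _ "T (x b)"]) auto
  qed
  have "((\<lambda>a. norm (T (x a) - y)) \<longlongrightarrow> 0) (tails A r)"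
    unfolding tendsto_iff
  proof (intro allI impI)
    fix e :: real assume "0 < e"
    then obtain a where a: "a \<in> A" "norm (T (x a) - y) < e" using cluster ne by blast
    have "norm (T (x b) - y) < e" if "b \<in> A" "(a, b) \<in> r" for b
    proof -
      have "norm (y - T (x b)) \<le> norm (y - T (x a))"
        using upper T_mono mono a that by (intro norm_mono_nonneg diff_left_mono) auto
      with a show ?thesis by (simp add: norm_minus_commute)
    qed
    then show "eventually (\<lambda>a. dist (norm (T (x a) - y)) 0 < e) (tails A r)"
      unfolding eventually_tails[OF dir] using a by (intro bexI[of _ a]) auto
  qed
  then show ?thesis by blast
qed

section \<open>Transfer of the codomain\<close>

text \<open>The parameter \<open>m\<close> is the record extension: \<open>()\<close> gives a plain
  normed structure, an order field gives a codomain lattice, and the facts about the norm serve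
  both.\<close>

definition left_copy :: "'m \<Rightarrow> ('a::banach_lattice + 'u, 'm) normed_structure_scheme"
  where "left_copy m = \<lparr>carrier = range Inl, mult = undefined, one = undefined, ring.zero = Inl 0,
    add = (\<lambda>x y. Inl (projl x + projl y)), smult = (\<lambda>c x. Inl (c *\<^sub>R projl x)),
    nrm = (\<lambda>x. norm (projl x)), \<dots> = m\<rparr>"

lemma left_copy_simps [simp]:
  "carrier (left_copy m) = range Inl" "\<zero>\<^bsub>left_copy m\<^esub> = Inl 0"
  "Inl x \<oplus>\<^bsub>left_copy m\<^esub> Inl y = Inl (x + y)" "c \<odot>\<^bsub>left_copy m\<^esub> Inl x = Inl (c *\<^sub>R x)"
  "nrm (left_copy m) (Inl x) = norm x"
  by (simp_all add: left_copy_def)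

lemma abelian_left_copy: "abelian_group (left_copy m :: ('a::banach_lattice + 'u, 'm) normed_structure_scheme)"
proof (rule abelian_groupI)
  fix x :: "'a + 'u" assume "x \<in> carrier (left_copy m)"
  then obtain a where "x = Inl a" by auto
  then show "\<exists>y\<in>carrier (left_copy m). y \<oplus>\<^bsub>left_copy m\<^esub> x = \<zero>\<^bsub>left_copy m\<^esub>"
    by (intro bexI[of _ "Inl (- a)"]) auto
qed (auto simp: ac_simps)

lemma a_minus_left_copy [simp]:
  fixes m :: 'm and x y :: "'a::banach_lattice"
  defines "Y \<equiv> left_copy m :: ('a + 'u, 'm) normed_structure_scheme"
  shows "a_minus Y (Inl x) (Inl y) = Inl (x - y)"
proof -
  interpret abelian_group Y unfolding Y_def by (rule abelian_left_copy)
  have "a_inv Y (Inl y) = Inl (- y)"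
    by (rule minus_equality) (auto simp: Y_def)
  then show ?thesis by (simp add: a_minus_def Y_def)
qed

lemma banach_space_left_copy:
  "banach_space (left_copy (m :: 'm) :: ('a::banach_lattice + 'u, 'm) normed_structure_scheme)"
proof -
  let ?Y = "left_copy m :: ('a + 'u, 'm) normed_structure_scheme"
  have mod: "module real_ring ?Y"
    by (rule moduleI[OF cring_from_type_algebra abelian_left_copy])
      (auto simp: ring_of_type_algebra_def scaleR_add_left scaleR_add_right)
  have ndist: "ndist ?Y (Inl x) (Inl y) = dist x y" for x y
    by (simp add: ndist_def dist_norm)
  interpret Metric_space "range Inl :: ('a + 'u) set" "ndist ?Y"
    by unfold_locales (auto simp: ndist dist_commute dist_triangle, auto simp: ndist_def dist_norm norm_minus_commute)
  have "mcomplete"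
    unfolding mcomplete_def
  proof (intro allI impI)
    fix \<sigma> assume \<sigma>: "MCauchy \<sigma>"
    then have "\<forall>n. \<sigma> n \<in> range Inl" by (auto simp: MCauchy_def)
    then have "\<forall>n. \<exists>a. \<sigma> n = Inl a" by blast
    then obtain s where s: "\<And>n. \<sigma> n = Inl (s n)" by metis
    from \<sigma> have "Cauchy s" by (simp add: MCauchy_def Cauchy_def s ndist)
    then obtain l where l: "s \<longlonglongrightarrow> l" using Cauchy_convergent_iff by (auto simp: convergent_def)
    have "limitin mtopology \<sigma> (Inl l) sequentially"
      using l by (auto simp: limit_metric_sequentially s ndist lim_sequentially)
    then show "\<exists>y. limitin mtopology \<sigma> y sequentially" by blast
  qed
  with mod show ?thesis
    unfolding banach_space_def banach_space_axioms_def by (auto simp: norm_triangle_ineq)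
qed

definition left_lattice_copy :: "('a::banach_lattice + 'u) normed_order_structure"
  where "left_lattice_copy = left_copy \<lparr>leq = (\<lambda>x y. projl x \<le> projl y)\<rparr>"

lemma leq_left_lattice_copy [simp]: "leq left_lattice_copy (Inl x) (Inl y) \<longleftrightarrow> x \<le> y"
  by (simp add: left_lattice_copy_def left_copy_def)

lemma order_left_lattice_copy:
  "carrier (order_of (left_lattice_copy :: ('a::banach_lattice + 'u) normed_order_structure)) = range Inl"
  "le (order_of left_lattice_copy) x y = leq left_lattice_copy x y"
  "eq (order_of left_lattice_copy) = (=)"
  by (simp_all add: order_of_def left_lattice_copy_def)

lemma least_left_lattice_copy:
  "least (order_of left_lattice_copy) (Inl (sup x y :: 'a::banach_lattice) :: 'a + 'u)
    (Upper (order_of left_lattice_copy) {Inl x, Inl y})"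
  by (auto simp: least_def Upper_def order_left_lattice_copy)

lemma greatest_left_lattice_copy:
  "greatest (order_of left_lattice_copy) (Inl (inf x y :: 'a::banach_lattice) :: 'a + 'u)
    (Lower (order_of left_lattice_copy) {Inl x, Inl y})"
  by (auto simp: greatest_def Lower_def order_left_lattice_copy)

lemma lattice_left_lattice_copy:
  "Lattice.lattice (order_of (left_lattice_copy :: ('a::banach_lattice + 'u) normed_order_structure))"
proof -
  interpret partial_order "order_of (left_lattice_copy :: ('a + 'u) normed_order_structure)"
    by unfold_locales (auto simp: order_left_lattice_copy)
  show ?thesis
    by unfold_locales
      (auto simp: order_left_lattice_copy intro: least_left_lattice_copy greatest_left_lattice_copy)
qed

lemma banach_lattice_space_left_lattice_copy:
  "banach_lattice_space (left_lattice_copy :: ('a::banach_lattice + 'u) normed_order_structure)"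
proof -
  let ?F = "left_lattice_copy :: ('a + 'u) normed_order_structure"
  interpret lat: Lattice.lattice "order_of ?F" by (rule lattice_left_lattice_copy)
  have bs: "banach_space ?F" unfolding left_lattice_copy_def by (rule banach_space_left_copy)
  have [simp]: "carrier ?F = range Inl" "\<And>x. nrm ?F (Inl x) = norm x"
    "\<And>x y. Inl x \<oplus>\<^bsub>?F\<^esub> Inl y = Inl (x + y)" "\<And>c x. c \<odot>\<^bsub>?F\<^esub> Inl x = Inl (c *\<^sub>R x)"
    by (simp_all add: left_lattice_copy_def)
  have modulus: "modulus ?F (Inl x) = Inl \<bar>x\<bar>" for x
  proof -
    interpret abelian_group ?F unfolding left_lattice_copy_def by (rule abelian_left_copy)
    have "\<ominus>\<^bsub>?F\<^esub> Inl x = Inl (- x)"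
      by (rule minus_equality) (auto simp: left_lattice_copy_def)
    \<comment> \<open>\<open>join\<close> chooses some least upper bound, so its value is determined
      by uniqueness.\<close>
    moreover have "join (order_of ?F) (Inl x) (Inl (- x)) = Inl (sup x (- x))"
      unfolding Lattice.join_def sup_def
      by (rule some_equality) (auto intro: least_left_lattice_copy lat.least_unique)
    ultimately show ?thesis by (simp add: modulus_def abs_lattice)
  qed
  show ?thesis
    unfolding banach_lattice_space_def banach_lattice_space_axioms_def
    using bs lattice_left_lattice_copy by (auto simp: modulus scaleR_left_mono norm_mono_abs)
qed

lemma left_copy_bounded_ops_iff:
  "(Inl \<circ> T :: 'a::banach_lattice \<Rightarrow> 'b::banach_lattice + 'u) \<in> bounded_ops (left_copy m) \<longleftrightarrow>
    T \<in> bounded_ops self"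
  by (simp add: bounded_ops_def image_subset_iff, simp add: self_def)

text \<open>Beyond boundedness, the KB condition sees the codomain only through norms of differences
  of values of \<open>T\<close>, which \<open>Inl\<close> preserves.\<close>

lemma left_copy_KB_ops_iff:
  "(Inl \<circ> T :: 'a::banach_lattice \<Rightarrow> 'b::banach_lattice + 'u) \<in> KB_ops TYPE('i) (left_copy m) \<longleftrightarrow>
    T \<in> KB_ops TYPE('i) self"
  by (simp add: KB_ops_def left_copy_bounded_ops_iff nrm_minus_self)

lemma left_copy_qKB_ops_iff:
  "(Inl \<circ> T :: 'a::banach_lattice \<Rightarrow> 'b::banach_lattice + 'u) \<in> qKB_ops TYPE('i) (left_copy m) \<longleftrightarrow>
    T \<in> qKB_ops TYPE('i) self"
  by (simp add: qKB_ops_def left_copy_bounded_ops_iff nrm_minus_self, simp add: self_def)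

lemma left_lattice_copy_positive_iff:
  "(Inl \<circ> T :: 'a::banach_lattice \<Rightarrow> 'b::banach_lattice + 'u) \<in> positive_maps left_lattice_copy \<longleftrightarrow>
    T \<in> positive_maps self"
proof -
  have "\<zero>\<^bsub>left_lattice_copy\<^esub> = (Inl 0 :: 'b + 'u)" by (simp add: left_lattice_copy_def)
  then show ?thesis by (simp add: positive_maps_def, simp add: self_def)
qed

lemma compact_positive_qKB:
  assumes "T \<in> compact_ops self" "(T :: 'a::banach_lattice \<Rightarrow> 'b::banach_lattice) \<in> positive_maps self"
  shows "T \<in> qKB_ops TYPE('i) self"
proof -
  have "T \<in> bounded_ops self" using assms(1) by (simp add: compact_ops_def)
  moreover have "carrier (self :: 'b normed_order_structure) = UNIV" by (simp add: self_def)
  moreover have "\<exists>y. ((\<lambda>a. norm (T (x a) - y)) \<longlongrightarrow> 0) (tails A r)"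
    if "increasing_ball_net A r x" for A :: "'i set" and r x
    using compact_positive_net_convergent[OF assms that] .
  ultimately show ?thesis unfolding qKB_ops_def nrm_minus_self by simp
qed

section \<open>Equivalence of the six conditions\<close>

theorem theorem3:
  assumes "order_continuous_norm TYPE('a + 'u) TYPE('a::banach_lattice)"
  shows "(KB_space TYPE('a) \<longleftrightarrow>
      (\<forall>Y :: ('a + 'u) normed_structure. banach_space Y \<longrightarrow>
        (bounded_ops Y :: ('a \<Rightarrow> 'a + 'u) set) = KB_ops TYPE('a + 'u) Y))
    \<and> (KB_space TYPE('a) \<longleftrightarrow>
      (\<forall>Y :: ('a + 'u) normed_structure. banach_space Y \<longrightarrow>
        (qKB_ops TYPE('a + 'u) Y :: ('a \<Rightarrow> 'a + 'u) set) = KB_ops TYPE('a + 'u) Y))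
    \<and> (KB_space TYPE('a) \<longleftrightarrow>
      (\<forall>F :: ('a + 'u) normed_order_structure. banach_lattice_space F \<longrightarrow>
        (qKB_ops TYPE('a + 'u) F \<inter> positive_maps F :: ('a \<Rightarrow> 'a + 'u) set) =
          KB_ops TYPE('a + 'u) F \<inter> positive_maps F))
    \<and> (KB_space TYPE('a) \<longleftrightarrow>
      (qKB_ops TYPE('a + 'u) self \<inter> positive_maps self :: ('a \<Rightarrow> 'a) set) =
        KB_ops TYPE('a + 'u) self \<inter> positive_maps self)
    \<and> (KB_space TYPE('a) \<longleftrightarrow>
      (compact_ops self \<inter> positive_maps self :: ('a \<Rightarrow> 'a) set) \<subseteq> KB_ops TYPE('a + 'u) self)"
proof (cases "KB_space TYPE('a)")
  case True
  have "banach_space (self :: 'a normed_order_structure)"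
    using banach_lattice_space_self by (rule banach_lattice_space.axioms)
  note self_eq = KB_space_imp_bounded_ops_eq_KB_ops[OF True this, where 'i = "'a + 'u"]
    KB_space_imp_qKB_ops_eq_KB_ops[OF True this, where 'i = "'a + 'u"]
  have "(compact_ops self \<inter> positive_maps self :: ('a \<Rightarrow> 'a) set) \<subseteq> KB_ops TYPE('a + 'u) self"
    unfolding self_eq(1)[symmetric] by (auto simp: compact_ops_def)
  moreover have "(bounded_ops Y :: ('a \<Rightarrow> 'a + 'u) set) = KB_ops TYPE('a + 'u) Y"
    "(qKB_ops TYPE('a + 'u) Y :: ('a \<Rightarrow> 'a + 'u) set) = KB_ops TYPE('a + 'u) Y"
    if "banach_space Y" for Y :: "('a + 'u) normed_structure"
    using KB_space_imp_bounded_ops_eq_KB_ops[OF True that] KB_space_imp_qKB_ops_eq_KB_ops[OF True that] .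
  moreover have "(qKB_ops TYPE('a + 'u) F :: ('a \<Rightarrow> 'a + 'u) set) = KB_ops TYPE('a + 'u) F"
    if "banach_lattice_space F" for F :: "('a + 'u) normed_order_structure"
    by (rule KB_space_imp_qKB_ops_eq_KB_ops[OF True banach_lattice_space.axioms(1)[OF that]])
  ultimately show ?thesis using True self_eq(2) by simp
next
  case False
  obtain T :: "'a \<Rightarrow> 'a" where T: "T \<in> compact_ops self" "T \<in> positive_maps self"
    and not_KB: "T \<notin> KB_ops TYPE('a + 'u) self"
    using compact_positive_not_KB[OF order_continuous_norm_imp_convergent[OF assms] False] by blast
  have qKB: "T \<in> qKB_ops TYPE('a + 'u) self" by (rule compact_positive_qKB[OF T])
  then have bd: "T \<in> bounded_ops self" using qKB_ops_subset_bounded_ops by blast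
  \<comment> \<open>One operator refutes all five conditions: \<open>T\<close> itself for those on
    the lattice alone, and its copy \<open>?S\<close> for those quantifying over codomains in
    \<open>'a + 'u\<close>.\<close>
  let ?S = "Inl \<circ> T :: 'a \<Rightarrow> 'a + 'u" and ?Y = "left_copy () :: ('a + 'u) normed_structure"
  let ?F = "left_lattice_copy :: ('a + 'u) normed_order_structure"
  have Y: "banach_space ?Y" "?S \<in> bounded_ops ?Y" "?S \<in> qKB_ops TYPE('a + 'u) ?Y"
    "?S \<notin> KB_ops TYPE('a + 'u) ?Y"
    using bd qKB not_KB
    by (simp_all add: banach_space_left_copy left_copy_bounded_ops_iff left_copy_qKB_ops_iff left_copy_KB_ops_iff)
  have F: "banach_lattice_space ?F" "?S \<in> qKB_ops TYPE('a + 'u) ?F \<inter> positive_maps ?F"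
    "?S \<notin> KB_ops TYPE('a + 'u) ?F"
    using qKB not_KB T(2)
    by (simp_all add: banach_lattice_space_left_lattice_copy left_lattice_copy_positive_iff)
      (simp_all add: left_lattice_copy_def left_copy_qKB_ops_iff left_copy_KB_ops_iff)
  have "\<exists>Y :: ('a + 'u) normed_structure. banach_space Y \<and>
      (bounded_ops Y :: ('a \<Rightarrow> 'a + 'u) set) \<noteq> KB_ops TYPE('a + 'u) Y"
    using Y by (intro exI[of _ ?Y]) auto
  moreover have "\<exists>Y :: ('a + 'u) normed_structure. banach_space Y \<and>
      (qKB_ops TYPE('a + 'u) Y :: ('a \<Rightarrow> 'a + 'u) set) \<noteq> KB_ops TYPE('a + 'u) Y"
    using Y by (intro exI[of _ ?Y]) auto
  moreover have "\<exists>F :: ('a + 'u) normed_order_structure. banach_lattice_space F \<and>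
      (qKB_ops TYPE('a + 'u) F \<inter> positive_maps F :: ('a \<Rightarrow> 'a + 'u) set) \<noteq>
        KB_ops TYPE('a + 'u) F \<inter> positive_maps F"
    using F by (intro exI[of _ ?F]) auto
  moreover have "(qKB_ops TYPE('a + 'u) self \<inter> positive_maps self :: ('a \<Rightarrow> 'a) set) \<noteq>
      KB_ops TYPE('a + 'u) self \<inter> positive_maps self"
    using T(2) qKB not_KB by blast
  moreover have "\<not> (compact_ops self \<inter> positive_maps self :: ('a \<Rightarrow> 'a) set) \<subseteq> KB_ops TYPE('a + 'u) self"
    using T not_KB by blast
  ultimately show ?thesis using False by simp
qed

end
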